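(* Let $\kappa<0$ and let $x>0$ be fixed. For $\ell<0$ let $Z=\ell-X_{\tau(\ell)}$ be the undershoot. For all $\zeta\ge0$ it holds that $$\lim_{\ell\to-\infty}\mathbb{E}^x\big[e^{-\zeta Z}\big]=\frac{\mu_1}{\mu_1+\zeta}.$$
   Context: Let $\kappa\in\mathbb{R}\setminus\{0\}$, $\lambda>0$. The real-valued process $X$ solves $dX_t=\kappa X_t\,dt+dU_t$, where $U_t=\sum_{n=1}^{N_t}V_n$, $(N_t)$ is a Poisson process with parameter $\lambda$ and $(V_n)$ are iid with distribution $G$, independent of $(N_t)$. Here $G=pG_-+qG_+$, $0<p\le 1$, $q=1-p$, $G_-(du)=\sum_{k=1}^r\alpha_k\mu_ke^{\mu_ku}\,du$ for $u<0$, and $G_+(du)=\sum_{d=1}^s\beta_d\nu_de^{-\nu_du}\,du$ for $u>0$, with $0<\mu_1<\dots<\mu_r$, $0<\nu_1<\dots<\nu_s$, all $\alpha_k,\beta_d\neq0$, $\sum_k\alpha_k=1$, $\sum_d\beta_d=1$, $\alpha_1>0$, $\beta_1>0$ (the other $\alpha_k,\beta_d$ may be negative, provided $G_\pm$ are probability distributions). Under $\mathbb{P}^x$, with expectation $\mathbb{E}^x$, we have $X_0=x$. The passage time is $\tau(\ell)=\inf\{t>0: X_t\le\ell\}$ for $\ell<x$. When $\kappa<0$ the process is recurrent and $\mathbb{P}^x(\tau(\ell)<\infty)=1$, so $Z$ is almost surely well defined. *)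

theory Defs
  imports "HOL-Probability.Probability"
begin

text \<open>
  Times are reals, only nonnegative times being relevant. Path properties are required for every
  outcome rather than almost surely, so that hitting times, and the process at such times, are
  measurable without completing the underlying probability space.
\<close>

definition poisson_process :: "'a measure \<Rightarrow> real \<Rightarrow> (real \<Rightarrow> 'a \<Rightarrow> nat) \<Rightarrow> bool" where
  "poisson_process M rate N \<longleftrightarrow>
     (\<forall>t\<ge>0. N t \<in> measurable M (count_space UNIV)) \<and>
     (\<forall>\<omega>\<in>space M. N 0 \<omega> = 0 \<and> mono_on {0..} (\<lambda>t. N t \<omega>) \<and>
        (\<forall>t\<ge>0. continuous (at_right t) (\<lambda>s. N s \<omega>))) \<and>
     (\<forall>(m::nat) (t :: nat \<Rightarrow> real). 0 \<le> t 0 \<and> mono_on {..m} t \<longrightarrow>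
        prob_space.indep_vars M (\<lambda>_. count_space UNIV)
          (\<lambda>i \<omega>. N (t (Suc i)) \<omega> - N (t i) \<omega>) {..<m}) \<and>
     (\<forall>s t. 0 \<le> s \<and> s < t \<longrightarrow>
        distr M (count_space UNIV) (\<lambda>\<omega>. N t \<omega> - N s \<omega>) = measure_pmf (poisson_pmf (rate * (t - s))))"

definition generated_events :: "'a measure \<Rightarrow> 'i set \<Rightarrow> ('i \<Rightarrow> 'a \<Rightarrow> 'b) \<Rightarrow> 'b measure \<Rightarrow> 'a set set" where
  "generated_events M I Y S =
     sigma_sets (space M) {Y i -` A \<inter> space M | i A. i \<in> I \<and> A \<in> sets S}"

definition hyperexp_density :: "nat \<Rightarrow> (nat \<Rightarrow> real) \<Rightarrow> (nat \<Rightarrow> real) \<Rightarrow> real \<Rightarrow> real" where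
  "hyperexp_density r a m u = (if u > 0 then \<Sum>k=1..r. a k * m k * exp (- m k * u) else 0)"

text \<open>
  Weights other than the first may be negative. Since the weights sum to 1, the signed density
  integrates to 1, so nonnegativity of the density says precisely that it is the density of a
  probability distribution.
\<close>

definition hyperexp_parameters :: "nat \<Rightarrow> (nat \<Rightarrow> real) \<Rightarrow> (nat \<Rightarrow> real) \<Rightarrow> bool" where
  "hyperexp_parameters r a m \<longleftrightarrow>
     0 < m 1 \<and> strict_mono_on {1..r} m \<and>
     (\<forall>k\<in>{1..r}. a k \<noteq> 0) \<and> (\<Sum>k=1..r. a k) = 1 \<and> a 1 > 0 \<and>
     (\<forall>u>0. hyperexp_density r a m u \<ge> 0)"

text \<open>The density of \<open>p G\<^sub>- + (1 - p) G\<^sub>+\<close>, where \<open>G\<^sub>-\<close> lives on the negative half-line.\<close>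

definition jump_density ::
    "real \<Rightarrow> nat \<Rightarrow> (nat \<Rightarrow> real) \<Rightarrow> (nat \<Rightarrow> real) \<Rightarrow> nat \<Rightarrow> (nat \<Rightarrow> real) \<Rightarrow> (nat \<Rightarrow> real) \<Rightarrow> real \<Rightarrow> real" where
  "jump_density p r \<alpha> \<mu> s \<beta> \<nu> u =
     p * hyperexp_density r \<alpha> \<mu> (- u) + (1 - p) * hyperexp_density s \<beta> \<nu> u"

definition compound_sum :: "(real \<Rightarrow> 'a \<Rightarrow> nat) \<Rightarrow> (nat \<Rightarrow> 'a \<Rightarrow> real) \<Rightarrow> real \<Rightarrow> 'a \<Rightarrow> real" where
  "compound_sum N V t \<omega> = (\<Sum>n=1..N t \<omega>. V n \<omega>)"

text \<open>Integrated form of \<open>dX\<^sub>t = \<kappa> X\<^sub>t dt + dU\<^sub>t\<close>, \<open>X\<^sub>0 = x\<close> (with \<open>U\<^sub>0 = 0\<close>).\<close>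

definition solves_linear_sde ::
    "'a measure \<Rightarrow> real \<Rightarrow> real \<Rightarrow> (real \<Rightarrow> 'a \<Rightarrow> real) \<Rightarrow> (real \<Rightarrow> 'a \<Rightarrow> real) \<Rightarrow> bool" where
  "solves_linear_sde M \<kappa> x U X \<longleftrightarrow>
     (\<forall>\<omega>\<in>space M. \<forall>t\<ge>0. (\<lambda>s. X s \<omega>) integrable_on {0..t} \<and>
        X t \<omega> = x + integral {0..t} (\<lambda>s. \<kappa> * X s \<omega>) + U t \<omega>)"

definition passage_time :: "(real \<Rightarrow> 'a \<Rightarrow> real) \<Rightarrow> real \<Rightarrow> 'a \<Rightarrow> ereal" where
  "passage_time X l \<omega> = (INF t\<in>{t. 0 < t \<and> X t \<omega> \<le> l}. ereal t)"

text \<open>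
  The undershoot is meaningful only when the passage time is finite. On the remaining null event
  \<open>real_of_ereal\<close> turns \<open>\<infinity>\<close> into 0, giving the irrelevant value \<open>l - X 0 \<omega>\<close>.
\<close>

definition undershoot :: "(real \<Rightarrow> 'a \<Rightarrow> real) \<Rightarrow> real \<Rightarrow> 'a \<Rightarrow> real" where
  "undershoot X l \<omega> = l - X (real_of_ereal (passage_time X l \<omega>)) \<omega>"

end

theory Submission
  imports Defs "HOL-Real_Asymp.Real_Asymp"
begin

text \<open>
  Since \<open>\<kappa> < 0\<close>, below level \<open>0\<close> the process drifts upwards between jumps, so a negative level \<open>l\<close> can
  only be passed by a jump. Hence passage is an event of the chain \<open>Y\<close> of states right after the jumps,
  \<open>Y (n + 1) = e\<^bsup>\<kappa> S\<^esup> Y n + J\<close>, where \<open>S\<close> is an exponential holding time and \<open>J\<close> a jump, both independent of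
  the past (\<open>embedded_chain\<close>), and the undershoot is \<open>l - Y\<close> at the first chain index with \<open>Y \<le> l\<close>
  (\<open>passage_at_jump\<close>).

  Let \<open>d\<close> be the distance from the state just before a jump down to \<open>l\<close>. Given that the jump passes \<open>l\<close>,
  the Laplace transform of the undershoot is a quotient of two exponential sums in \<open>d\<close>, in which the
  smallest rate \<open>\<mu> 1\<close> dominates; it tends to \<open>\<mu> 1 / (\<mu> 1 + \<zeta>)\<close> as \<open>d \<longlongrightarrow> \<infinity>\<close> (\<open>laplace_ratio\<close>). It remains
  to see that the level is almost never passed from a distance below a constant \<open>C\<close> (\<open>hitting_error\<close>).
  A process starting above \<open>0\<close> comes that close to \<open>l\<close> only by first landing in \<open>(l, l + C)\<close> and then
  waiting less than a time \<open>\<epsilon>\<close> for the next jump, because at depth \<open>l\<close> the upward drift has speed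
  \<open>\<kappa> l\<close>; here \<open>\<epsilon> \<longlongrightarrow> 0\<close> as \<open>l \<longlongrightarrow> -\<infinity>\<close>. Landing in \<open>(l, l + C)\<close> is at most \<open>K\<close> times as likely as
  landing below \<open>l\<close>, by the regularity of the jump tail (\<open>below_shift\<close>). Passage happens only once, so
  the expected number of landings in \<open>(l, l + C)\<close> before passage is at most \<open>K\<close>, uniformly in \<open>l\<close>, and
  the probability of a passage from a distance below \<open>C\<close> is at most \<open>K\<close> times the probability that a
  holding time is at most \<open>\<epsilon>\<close> (\<open>prob_near_miss_Suc\<close>).

  Passage is almost sure since \<open>\<bar>Y n\<bar>\<close> has bounded mean: the chain keeps returning to a bounded set, from
  which every jump passes \<open>l\<close> with probability bounded below (\<open>prob_alive_tendsto_0\<close>).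

  The independence of the holding times is the strong Markov property of the Poisson process at its
  arrival times, obtained by approximating these from the right by grid times (\<open>prob_holding\<close>).
\<close>

section \<open>Integration against an independent variable\<close>

text \<open>
  If \<open>Z\<close> is independent of the \<open>\<sigma>\<close>-algebra \<open>F\<close>, the outcome itself, observed through \<open>F\<close>, and \<open>Z\<close> have a
  product law. Keeping the whole outcome as first component lets the two integral formulas below be
  used for any integrand that depends on the outcome in an \<open>F\<close>-measurable way.
\<close>

lemma (in prob_space) distr_pair_independent:
  assumes sub: "subalgebra M F" and Z [measurable]: "Z \<in> borel_measurable M"
    and \<nu>: "prob_space \<nu>" "sets \<nu> = sets borel"
    and ind: "\<And>A B. A \<in> sets F \<Longrightarrow> B \<in> sets borel \<Longrightarrow>
      prob (A \<inter> (Z -` B \<inter> space M)) = prob A * measure \<nu> B"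
  shows "distr M (F \<Otimes>\<^sub>M borel) (\<lambda>\<omega>. (\<omega>, Z \<omega>)) = distr M F (\<lambda>\<omega>. \<omega>) \<Otimes>\<^sub>M \<nu>"
proof -
  have [measurable]: "(\<lambda>\<omega>. \<omega>) \<in> M \<rightarrow>\<^sub>M F"
    using sub measurable_from_subalg[OF sub measurable_ident] by (simp add: id_def)
  interpret F: prob_space "distr M F (\<lambda>\<omega>. \<omega>)" by (rule prob_space_distr) simp
  interpret \<nu>: prob_space \<nu> by fact
  have "distr M F (\<lambda>\<omega>. \<omega>) \<Otimes>\<^sub>M \<nu> = distr M (F \<Otimes>\<^sub>M borel) (\<lambda>\<omega>. (\<omega>, Z \<omega>))"
  proof (rule pair_measure_eqI)
    show "sigma_finite_measure (distr M F (\<lambda>\<omega>. \<omega>))" "sigma_finite_measure \<nu>"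
      by unfold_locales
    show "sets (distr M F (\<lambda>\<omega>. \<omega>) \<Otimes>\<^sub>M \<nu>) = sets (distr M (F \<Otimes>\<^sub>M borel) (\<lambda>\<omega>. (\<omega>, Z \<omega>)))"
      using \<nu>(2) by (simp cong: sets_pair_measure_cong)
  next
    fix A B assume A: "A \<in> sets (distr M F (\<lambda>\<omega>. \<omega>))" and B: "B \<in> sets \<nu>"
    have [measurable]: "A \<in> sets F" "B \<in> sets borel" using A B \<nu>(2) by auto
    have AM: "A \<in> sets M" "A \<subseteq> space M"
      using sub sets.sets_into_space[of A F] \<open>A \<in> sets F\<close> unfolding subalgebra_def by blast+
    have "(\<lambda>\<omega>. (\<omega>, Z \<omega>)) -` (A \<times> B) \<inter> space M = A \<inter> (Z -` B \<inter> space M)" by auto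
    moreover have "(\<lambda>\<omega>. \<omega>) -` A \<inter> space M = A" using AM by auto
    ultimately show "emeasure (distr M F (\<lambda>\<omega>. \<omega>)) A * emeasure \<nu> B =
        emeasure (distr M (F \<Otimes>\<^sub>M borel) (\<lambda>\<omega>. (\<omega>, Z \<omega>))) (A \<times> B)"
      using ind[of A B] B by (simp add: emeasure_distr emeasure_eq_measure \<nu>.emeasure_eq_measure
         flip: ennreal_mult)
  qed
  then show ?thesis by simp
qed

lemma (in prob_space) nn_integral_independent:
  assumes sub: "subalgebra M F" and Z [measurable]: "Z \<in> borel_measurable M"
    and \<nu>: "prob_space \<nu>" "sets \<nu> = sets borel"
    and ind: "\<And>A B. A \<in> sets F \<Longrightarrow> B \<in> sets borel \<Longrightarrow>
      prob (A \<inter> (Z -` B \<inter> space M)) = prob A * measure \<nu> B"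
    and g: "(\<lambda>(\<omega>, v). g \<omega> v) \<in> borel_measurable (F \<Otimes>\<^sub>M borel)"
  shows "(\<integral>\<^sup>+\<omega>. g \<omega> (Z \<omega>) \<partial>M) = (\<integral>\<^sup>+\<omega>. \<integral>\<^sup>+v. g \<omega> v \<partial>\<nu> \<partial>M)"
proof -
  have [measurable]: "(\<lambda>\<omega>. \<omega>) \<in> M \<rightarrow>\<^sub>M F"
    using sub measurable_from_subalg[OF sub measurable_ident] by (simp add: id_def)
  interpret \<nu>: prob_space \<nu> by fact
  have g': "(\<lambda>(\<omega>, v). g \<omega> v) \<in> borel_measurable (distr M F (\<lambda>\<omega>. \<omega>) \<Otimes>\<^sub>M \<nu>)"
    using g \<nu>(2) by (simp cong: measurable_cong_sets sets_pair_measure_cong)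
  have g'': "(\<lambda>(\<omega>, v). g \<omega> v) \<in> borel_measurable (F \<Otimes>\<^sub>M \<nu>)"
    using g \<nu>(2) by (simp cong: measurable_cong_sets sets_pair_measure_cong)
  have eq: "distr M (F \<Otimes>\<^sub>M borel) (\<lambda>\<omega>. (\<omega>, Z \<omega>)) = distr M F (\<lambda>\<omega>. \<omega>) \<Otimes>\<^sub>M \<nu>"
    by (rule distr_pair_independent) (use assms in auto)
  have "(\<integral>\<^sup>+\<omega>. g \<omega> (Z \<omega>) \<partial>M) = (\<integral>\<^sup>+y. (case y of (\<omega>, v) \<Rightarrow> g \<omega> v)
      \<partial>distr M (F \<Otimes>\<^sub>M borel) (\<lambda>\<omega>. (\<omega>, Z \<omega>)))"
    using g by (subst nn_integral_distr) auto
  also have "\<dots> = (\<integral>\<^sup>+\<omega>. \<integral>\<^sup>+v. g \<omega> v \<partial>\<nu> \<partial>distr M F (\<lambda>\<omega>. \<omega>))"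
    unfolding eq using \<nu>.nn_integral_fst[OF g'] by simp
  also have "\<dots> = (\<integral>\<^sup>+\<omega>. \<integral>\<^sup>+v. g \<omega> v \<partial>\<nu> \<partial>M)"
    using g'' by (subst nn_integral_distr) (auto intro!: \<nu>.borel_measurable_nn_integral)
  finally show ?thesis .
qed

lemma (in prob_space) integral_independent:
  fixes g :: "'a \<Rightarrow> real \<Rightarrow> real"
  assumes sub: "subalgebra M F" and Z [measurable]: "Z \<in> borel_measurable M"
    and \<nu>: "prob_space \<nu>" "sets \<nu> = sets borel"
    and ind: "\<And>A B. A \<in> sets F \<Longrightarrow> B \<in> sets borel \<Longrightarrow>
      prob (A \<inter> (Z -` B \<inter> space M)) = prob A * measure \<nu> B"
    and g: "(\<lambda>(\<omega>, v). g \<omega> v) \<in> borel_measurable (F \<Otimes>\<^sub>M borel)"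
    and bd: "\<And>\<omega> v. \<bar>g \<omega> v\<bar> \<le> C"
  shows "(\<lambda>\<omega>. \<integral>v. g \<omega> v \<partial>\<nu>) \<in> borel_measurable F"
    and "(\<integral>\<omega>. g \<omega> (Z \<omega>) \<partial>M) = (\<integral>\<omega>. \<integral>v. g \<omega> v \<partial>\<nu> \<partial>M)"
proof -
  have [measurable]: "(\<lambda>\<omega>. \<omega>) \<in> M \<rightarrow>\<^sub>M F"
    using sub measurable_from_subalg[OF sub measurable_ident] by (simp add: id_def)
  interpret F: prob_space "distr M F (\<lambda>\<omega>. \<omega>)" by (rule prob_space_distr) simp
  interpret \<nu>: prob_space \<nu> by fact
  interpret P: pair_prob_space "distr M F (\<lambda>\<omega>. \<omega>)" \<nu> ..
  have g': "(\<lambda>(\<omega>, v). g \<omega> v) \<in> borel_measurable (distr M F (\<lambda>\<omega>. \<omega>) \<Otimes>\<^sub>M \<nu>)"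
    using g \<nu>(2) by (simp cong: measurable_cong_sets sets_pair_measure_cong)
  have g'': "(\<lambda>(\<omega>, v). g \<omega> v) \<in> borel_measurable (F \<Otimes>\<^sub>M \<nu>)"
    using g \<nu>(2) by (simp cong: measurable_cong_sets sets_pair_measure_cong)
  have gi: "integrable (distr M F (\<lambda>\<omega>. \<omega>) \<Otimes>\<^sub>M \<nu>) (\<lambda>(\<omega>, v). g \<omega> v)"
    using g' bd by (auto intro!: P.integrable_const_bound[of _ C])
  show m: "(\<lambda>\<omega>. \<integral>v. g \<omega> v \<partial>\<nu>) \<in> borel_measurable F"
    using g'' by (rule \<nu>.borel_measurable_lebesgue_integral)
  have eq: "distr M (F \<Otimes>\<^sub>M borel) (\<lambda>\<omega>. (\<omega>, Z \<omega>)) = distr M F (\<lambda>\<omega>. \<omega>) \<Otimes>\<^sub>M \<nu>"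
    by (rule distr_pair_independent) (use assms in auto)
  have "(\<integral>\<omega>. g \<omega> (Z \<omega>) \<partial>M) = (\<integral>y. (case y of (\<omega>, v) \<Rightarrow> g \<omega> v)
      \<partial>distr M (F \<Otimes>\<^sub>M borel) (\<lambda>\<omega>. (\<omega>, Z \<omega>)))"
    using g by (subst integral_distr) auto
  also have "\<dots> = (\<integral>\<omega>. \<integral>v. g \<omega> v \<partial>\<nu> \<partial>distr M F (\<lambda>\<omega>. \<omega>))"
    unfolding eq by (rule P.integral_fst'[OF gi, simplified, symmetric])
  also have "\<dots> = (\<integral>\<omega>. \<integral>v. g \<omega> v \<partial>\<nu> \<partial>M)"
    using m by (subst integral_distr) auto
  finally show "(\<integral>\<omega>. g \<omega> (Z \<omega>) \<partial>M) = (\<integral>\<omega>. \<integral>v. g \<omega> v \<partial>\<nu> \<partial>M)" .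
qed

section \<open>A chain with multiplicative decay and independent jumps\<close>

text \<open>
  The \<open>\<sigma>\<close>-algebra \<open>F n\<close> is the information available right after jump \<open>n\<close>, and \<open>H n\<close> the information right
  before jump \<open>n + 1\<close>, when the holding time \<open>S n\<close> is known but the jump \<open>J n\<close> is not. Only two features
  of the holding-time law \<open>\<sigma>\<close> matter: it is the same at every step and has no mass at \<open>0\<close>.
\<close>

locale decay_jump_chain = prob_space M for M :: "'a measure" +
  fixes F H :: "nat \<Rightarrow> 'a measure" and S J :: "nat \<Rightarrow> 'a \<Rightarrow> real"
    and \<sigma> \<nu> :: "real measure" and \<kappa> x :: real
  assumes subF: "\<And>n. subalgebra M (F n)" and subH: "\<And>n. subalgebra M (H n)"
    and FH: "\<And>n. subalgebra (H n) (F n)" and HF: "\<And>n. subalgebra (F (Suc n)) (H n)"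
    and S_meas: "\<And>n. S n \<in> borel_measurable (H n)"
    and J_meas: "\<And>n. J n \<in> borel_measurable (F (Suc n))"
    and \<sigma>: "prob_space \<sigma>" "sets \<sigma> = sets borel" "AE s in \<sigma>. 0 < s"
    and \<nu>: "prob_space \<nu>" "sets \<nu> = sets borel"
    and S_indep: "\<And>n A B. A \<in> sets (F n) \<Longrightarrow> B \<in> sets borel \<Longrightarrow>
      prob (A \<inter> (S n -` B \<inter> space M)) = prob A * measure \<sigma> B"
    and J_indep: "\<And>n A B. A \<in> sets (H n) \<Longrightarrow> B \<in> sets borel \<Longrightarrow>
      prob (A \<inter> (J n -` B \<inter> space M)) = prob A * measure \<nu> B"
    and J_moment: "integrable \<nu> (\<lambda>v. \<bar>v\<bar>)"
    and decay: "\<kappa> < 0"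
begin

sublocale \<sigma>: prob_space \<sigma> by (rule \<sigma>)
sublocale \<nu>: prob_space \<nu> by (rule \<nu>)

declare \<sigma>(2) [measurable_cong] \<nu>(2) [measurable_cong]

primrec Y :: "nat \<Rightarrow> 'a \<Rightarrow> real" where
  "Y 0 \<omega> = x"
| "Y (Suc n) \<omega> = exp (\<kappa> * S n \<omega>) * Y n \<omega> + J n \<omega>"

definition pre_jump :: "nat \<Rightarrow> 'a \<Rightarrow> real" where
  "pre_jump n \<omega> = exp (\<kappa> * S n \<omega>) * Y n \<omega>"

lemma spaces [simp]: "space (F n) = space M" "space (H n) = space M"
  using subF subH by (auto simp: subalgebra_def)

lemma sets_F_mono: "m \<le> n \<Longrightarrow> sets (F m) \<subseteq> sets (F n)"
proof (induction n rule: nat_induct_at_least)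
  case (Suc n)
  then show ?case using FH[of n] HF[of n] by (auto simp: subalgebra_def)
qed simp

lemma Y_measurable_F: "Y n \<in> borel_measurable (F n)"
proof (induction n)
  case (Suc n)
  have [measurable]: "Y n \<in> borel_measurable (F (Suc n))"
    using measurable_from_subalg[OF HF measurable_from_subalg[OF FH Suc]] .
  have [measurable]: "S n \<in> borel_measurable (F (Suc n))"
    using measurable_from_subalg[OF HF S_meas] .
  note J_meas[measurable]
  show ?case by (simp del: space_borel) measurable
qed simp

lemma Y_measurable [measurable]: "Y n \<in> borel_measurable M"
  by (rule measurable_from_subalg[OF subF Y_measurable_F])

lemma S_measurable [measurable]: "S n \<in> borel_measurable M"
  by (rule measurable_from_subalg[OF subH S_meas])

lemma J_measurable [measurable]: "J n \<in> borel_measurable M"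
  by (rule measurable_from_subalg[OF subF J_meas])

lemma pre_measurable_H: "pre_jump n \<in> borel_measurable (H n)"
proof -
  note S_meas[measurable]
  have [measurable]: "Y n \<in> borel_measurable (H n)"
    by (rule measurable_from_subalg[OF FH Y_measurable_F])
  show ?thesis unfolding pre_jump_def by measurable
qed

lemma pre_measurable [measurable]: "pre_jump n \<in> borel_measurable M"
  by (rule measurable_from_subalg[OF subH pre_measurable_H])

lemma Y_Suc_pre: "Y (Suc n) \<omega> = pre_jump n \<omega> + J n \<omega>"
  by (simp add: pre_jump_def)

lemma AE_S_pos: "AE \<omega> in M. 0 < S n \<omega>"
proof -
  have "prob (space M \<inter> (S n -` {0<..} \<inter> space M)) = prob (space M) * measure \<sigma> {0<..}"
    by (rule S_indep) (use sets.top[of "F n"] in auto)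
  also have "measure \<sigma> {0<..} = 1"
    using \<sigma>(3) \<sigma>.prob_Collect_eq_1[of "\<lambda>s. 0 < s"]
    by (simp add: greaterThan_def sets_eq_imp_space_eq[OF \<sigma>(2)])
  finally have "prob {\<omega>\<in>space M. 0 < S n \<omega>} = 1"
    by (simp add: prob_space vimage_def Int_def conj_commute)
  then show ?thesis by (subst (asm) prob_Collect_eq_1) auto
qed

definition alive :: "real \<Rightarrow> nat \<Rightarrow> 'a set" where
  "alive l n = {\<omega>\<in>space M. \<forall>i\<le>n. l < Y i \<omega>}"

text \<open>
  Passage of \<open>l\<close> at jump \<open>n + 1\<close>. These events are disjoint, so that their probabilities form the law of
  the passage index.
\<close>

definition hit :: "real \<Rightarrow> nat \<Rightarrow> 'a set" where
  "hit l n = {\<omega>\<in>alive l n. Y (Suc n) \<omega> \<le> l}"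

lemma alive_F: "alive l n \<in> sets (F n)"
proof -
  have [measurable]: "Y i \<in> borel_measurable (F n)" if "i \<le> n" for i
    using Y_measurable_F[of i] sets_F_mono[OF that] by (auto simp: measurable_def)
  have "{\<omega>\<in>space (F n). \<forall>i\<in>{..n}. l < Y i \<omega>} \<in> sets (F n)"
    by measurable
  then show ?thesis unfolding alive_def spaces Ball_def atMost_iff .
qed

lemma alive_H: "alive l n \<in> sets (H n)"
  using alive_F FH[of n] by (auto simp: subalgebra_def)

lemma alive_sets [measurable]: "alive l n \<in> sets M"
  using alive_F subF[of n] by (auto simp: subalgebra_def)

lemma hit_sets [measurable]: "hit l n \<in> sets M"
proof -
  have "hit l n = alive l n \<inter> {\<omega>\<in>space M. Y (Suc n) \<omega> \<le> l}"
    by (auto simp: hit_def alive_def)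
  then show ?thesis using Y_measurable[of "Suc n"] by (simp del: Y.simps)
qed

lemma alive_Suc: "alive l (Suc n) = alive l n - hit l n"
  by (auto simp: alive_def hit_def le_Suc_eq not_le)

lemma prob_alive_Suc: "prob (alive l (Suc n)) = prob (alive l n) - prob (hit l n)"
  unfolding alive_Suc by (rule finite_measure_Diff) (auto simp: hit_def)

text \<open>
  A state above a negative level stays above it while it decays towards \<open>0\<close>.
\<close>

lemma alive_pre_gt:
  assumes "l < 0"
  shows "AE \<omega> in M. \<omega> \<in> alive l n \<longrightarrow> l < pre_jump n \<omega>"
  using AE_S_pos[of n]
proof eventually_elim
  case (elim \<omega>)
  show ?case
  proof
    assume "\<omega> \<in> alive l n"
    then have y: "l < Y n \<omega>" by (auto simp: alive_def)
    have e: "0 < exp (\<kappa> * S n \<omega>)" "exp (\<kappa> * S n \<omega>) \<le> 1"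
      using elim decay by (auto simp: mult_nonpos_nonneg)
    show "l < pre_jump n \<omega>"
    proof (cases "0 \<le> Y n \<omega>")
      case True
      then have "0 \<le> pre_jump n \<omega>" by (simp add: pre_jump_def)
      then show ?thesis using \<open>l < 0\<close> by linarith
    next
      case False
      then have "1 * Y n \<omega> \<le> exp (\<kappa> * S n \<omega>) * Y n \<omega>"
        using e by (intro mult_right_mono_neg) auto
      then show ?thesis using y by (simp add: pre_jump_def)
    qed
  qed
qed


definition tail :: "real \<Rightarrow> real" where
  "tail d = measure \<nu> {..- d}"

text \<open>
  The transform of the undershoot for one jump made at distance \<open>d\<close> above the level, without dividing by
  the probability \<open>tail d\<close> that this jump passes the level.
\<close>

definition excess_laplace :: "real \<Rightarrow> real \<Rightarrow> real" where
  "excess_laplace \<zeta> d = (\<integral>v. indicator {..- d} v * exp (\<zeta> * (d + v)) \<partial>\<nu>)"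

lemma excess_laplace_zero: "excess_laplace 0 d = tail d"
  by (simp add: excess_laplace_def tail_def sets_eq_imp_space_eq[OF \<nu>(2)])

lemma exp_excess_le_1: "0 \<le> \<zeta> \<Longrightarrow> indicator {..- d} v * exp (\<zeta> * (d + v)) \<le> (indicator {..- d} v :: real)"
  by (auto simp: indicator_def mult_nonneg_nonpos)

lemma excess_laplace_bounds:
  assumes "0 \<le> \<zeta>"
  shows "0 \<le> excess_laplace \<zeta> d" "excess_laplace \<zeta> d \<le> tail d"
proof -
  show "0 \<le> excess_laplace \<zeta> d"
    unfolding excess_laplace_def by (intro integral_nonneg_AE) (auto simp: indicator_def)
  have "excess_laplace \<zeta> d \<le> (\<integral>v. indicator {..- d} v \<partial>\<nu>)"
    unfolding excess_laplace_def
  proof (rule integral_mono)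
    show "integrable \<nu> (\<lambda>v. indicator {..- d} v * exp (\<zeta> * (d + v)))"
      by (rule \<nu>.integrable_const_bound[of _ 1])
        (use assms in \<open>auto simp: abs_mult mult_nonneg_nonpos split: split_indicator\<close>)
    show "integrable \<nu> (indicator {..- d} :: real \<Rightarrow> real)"
      by (rule \<nu>.integrable_const_bound[of _ 1]) auto
  qed (use exp_excess_le_1[OF assms] in auto)
  then show "excess_laplace \<zeta> d \<le> tail d"
    by (simp add: tail_def sets_eq_imp_space_eq[OF \<nu>(2)])
qed

lemma tail_le_1: "tail d \<le> 1" and tail_nonneg: "0 \<le> tail d"
  by (auto simp: tail_def)

lemma tail_antimono: "d \<le> d' \<Longrightarrow> tail d' \<le> tail d"
  unfolding tail_def by (rule \<nu>.finite_measure_mono) (auto simp: \<nu>(2))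

text \<open>
  The jump is independent of \<open>H n\<close>, so conditionally on the pre-jump state it can be integrated out. The
  level is a parameter apart from \<open>A\<close> because near misses call for landings below \<open>l + C\<close> on \<open>alive l n\<close>.
\<close>

lemma jump_below_laplace:
  assumes A: "A \<in> sets (H n)" and "0 \<le> \<zeta>"
  shows "(\<lambda>\<omega>. excess_laplace \<zeta> (pre_jump n \<omega> - l)) \<in> borel_measurable M"
    and "(\<integral>\<omega>. indicator {\<omega>\<in>A. Y (Suc n) \<omega> \<le> l} \<omega> * exp (- \<zeta> * (l - Y (Suc n) \<omega>)) \<partial>M)
      = (\<integral>\<omega>. indicator A \<omega> * excess_laplace \<zeta> (pre_jump n \<omega> - l) \<partial>M)"
proof -
  note pre_measurable_H[measurable] A[measurable]
  define g where "g B \<omega> v = indicator B \<omega> *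
     (indicator {..- (pre_jump n \<omega> - l)} v * exp (\<zeta> * (pre_jump n \<omega> - l + v)) :: real)" for B \<omega> v
  have g_int: "(\<integral>v. g B \<omega> v \<partial>\<nu>) = indicator B \<omega> * excess_laplace \<zeta> (pre_jump n \<omega> - l)" for B \<omega>
    unfolding g_def excess_laplace_def by simp
  have g_meas: "(\<lambda>(\<omega>, v). g B \<omega> v) \<in> borel_measurable (H n \<Otimes>\<^sub>M borel)"
    if [measurable]: "B \<in> sets (H n)" for B
  proof -
    have "g B = (\<lambda>\<omega> v. indicator B \<omega> *
     ((if v \<le> - (pre_jump n \<omega> - l) then 1 else 0) * exp (\<zeta> * (pre_jump n \<omega> - l + v))))"
      by (auto simp: g_def indicator_def fun_eq_iff)
    then show ?thesis by simp
  qed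
  have g_bd: "\<bar>g B \<omega> v\<bar> \<le> 1" for B \<omega> v
    using \<open>0 \<le> \<zeta>\<close> by (auto simp: g_def indicator_def mult_nonneg_nonpos)
  have "(\<lambda>\<omega>. \<integral>v. g (space M) \<omega> v \<partial>\<nu>) \<in> borel_measurable (H n)"
    by (rule integral_independent(1)[OF subH J_measurable \<nu> J_indep g_meas g_bd])
      (use sets.top[of "H n"] in simp_all)
  then have "(\<lambda>\<omega>. indicator (space M) \<omega> * excess_laplace \<zeta> (pre_jump n \<omega> - l)) \<in> borel_measurable M"
    unfolding g_int by (rule measurable_from_subalg[OF subH])
  then show "(\<lambda>\<omega>. excess_laplace \<zeta> (pre_jump n \<omega> - l)) \<in> borel_measurable M"
    by (rule measurable_cong[THEN iffD1, rotated]) auto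
  have "(\<integral>\<omega>. g A \<omega> (J n \<omega>) \<partial>M) = (\<integral>\<omega>. \<integral>v. g A \<omega> v \<partial>\<nu> \<partial>M)"
    by (rule integral_independent(2)[OF subH J_measurable \<nu> J_indep g_meas g_bd]) (use A in simp_all)
  note this[unfolded g_int]
  moreover have "g A \<omega> (J n \<omega>) =
     indicator {\<omega>\<in>A. Y (Suc n) \<omega> \<le> l} \<omega> * exp (- \<zeta> * (l - Y (Suc n) \<omega>))" for \<omega>
    by (auto simp: g_def indicator_def Y_Suc_pre algebra_simps simp del: Y.simps)
  ultimately show "(\<integral>\<omega>. indicator {\<omega>\<in>A. Y (Suc n) \<omega> \<le> l} \<omega> * exp (- \<zeta> * (l - Y (Suc n) \<omega>)) \<partial>M)
      = (\<integral>\<omega>. indicator A \<omega> * excess_laplace \<zeta> (pre_jump n \<omega> - l) \<partial>M)"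
    by simp
qed

lemma tail_measurable: "(\<lambda>\<omega>. tail (pre_jump n \<omega> - l)) \<in> borel_measurable M"
  using jump_below_laplace(1)[of "space M" n 0] sets.top[of "H n"] by (simp add: excess_laplace_zero)

lemma prob_jump_below:
  assumes A: "A \<in> sets (H n)"
  shows "prob {\<omega>\<in>A. Y (Suc n) \<omega> \<le> l} = (\<integral>\<omega>. indicator A \<omega> * tail (pre_jump n \<omega> - l) \<partial>M)"
proof -
  have "A \<in> sets M" using A subH[of n] by (auto simp: subalgebra_def)
  then have "A \<inter> {\<omega>\<in>space M. Y (Suc n) \<omega> \<le> l} \<in> sets M"
    using Y_measurable[of "Suc n"] by (simp del: Y.simps)
  also have "A \<inter> {\<omega>\<in>space M. Y (Suc n) \<omega> \<le> l} = {\<omega>\<in>A. Y (Suc n) \<omega> \<le> l}"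
    using sets.sets_into_space[OF \<open>A \<in> sets M\<close>] by auto
  finally have "prob {\<omega>\<in>A. Y (Suc n) \<omega> \<le> l} = (\<integral>\<omega>. indicator {\<omega>\<in>A. Y (Suc n) \<omega> \<le> l} \<omega> \<partial>M)"
    by simp
  with jump_below_laplace(2)[OF A, of 0 l] show ?thesis
    by (simp add: excess_laplace_zero del: Y.simps)
qed

lemma prob_hit: "prob (hit l n) = (\<integral>\<omega>. indicator (alive l n) \<omega> * tail (pre_jump n \<omega> - l) \<partial>M)"
  unfolding hit_def by (rule prob_jump_below[OF alive_H])

text \<open>
  Strict inequality comes from the holding time being positive almost surely.
\<close>

lemma contraction_factor: "(\<integral>s. exp (\<kappa> * s) \<partial>\<sigma>) < 1" "integrable \<sigma> (\<lambda>s. exp (\<kappa> * s))"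
proof -
  have le: "AE s in \<sigma>. exp (\<kappa> * s) < 1"
    using \<sigma>(3) by eventually_elim (use decay in \<open>simp add: mult_neg_pos\<close>)
  show i: "integrable \<sigma> (\<lambda>s. exp (\<kappa> * s))"
    by (rule \<sigma>.integrable_const_bound[of _ 1]) (use le in \<open>auto elim!: eventually_mono\<close>)
  have "(\<integral>s. 1 - exp (\<kappa> * s) \<partial>\<sigma>) \<noteq> 0"
  proof
    assume "(\<integral>s. 1 - exp (\<kappa> * s) \<partial>\<sigma>) = 0"
    then have "AE s in \<sigma>. 1 - exp (\<kappa> * s) = 0"
      by (subst (asm) integral_nonneg_eq_0_iff_AE) (use le i in \<open>auto elim!: eventually_mono\<close>)
    with le have "AE s in \<sigma>. False" by eventually_elim auto
    then show False by simp
  qed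
  moreover have "0 \<le> (\<integral>s. 1 - exp (\<kappa> * s) \<partial>\<sigma>)"
    by (rule integral_nonneg_AE) (use le in \<open>auto elim!: eventually_mono\<close>)
  ultimately show "(\<integral>s. exp (\<kappa> * s) \<partial>\<sigma>) < 1" using i by (simp add: \<sigma>.prob_space)
qed

text \<open>
  The recursion gives \<open>E \<bar>Y (n + 1)\<bar> \<le> \<rho> E \<bar>Y n\<bar> + m\<close> with \<open>\<rho> = E e\<^bsup>\<kappa> S\<^esup> < 1\<close> and \<open>m = E \<bar>J\<bar>\<close>.
\<close>

lemma Y_moment_bound: obtains B where "0 \<le> B" "\<And>n. integrable M (Y n)" "\<And>n. (\<integral>\<omega>. \<bar>Y n \<omega>\<bar> \<partial>M) \<le> B"
proof -
  define \<rho> where "\<rho> = (\<integral>s. exp (\<kappa> * s) \<partial>\<sigma>)"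
  define m where "m = (\<integral>v. \<bar>v\<bar> \<partial>\<nu>)"
  define B where "B = \<bar>x\<bar> + m / (1 - \<rho>)"
  have \<rho>: "0 \<le> \<rho>" "\<rho> < 1" using contraction_factor by (auto simp: \<rho>_def)
  have m: "0 \<le> m" by (auto simp: m_def)
  have B: "0 \<le> B" "\<rho> * B + m \<le> B"
  proof -
    show "0 \<le> B" using \<rho> m by (auto simp: B_def)
    have "\<rho> * (m / (1 - \<rho>)) + m = m / (1 - \<rho>)" using \<rho> by (simp add: field_simps)
    moreover have "\<rho> * \<bar>x\<bar> \<le> \<bar>x\<bar>" using \<rho> by (simp add: mult_left_le_one_le)
    ultimately show "\<rho> * B + m \<le> B" by (simp add: B_def algebra_simps)
  qed
  have nn: "(\<integral>\<^sup>+\<omega>. ennreal \<bar>Y n \<omega>\<bar> \<partial>M) \<le> ennreal B" for n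
  proof (induction n)
    case 0
    then show ?case using \<rho> m by (auto simp: B_def emeasure_space_1)
  next
    case (Suc n)
    note Y_measurable_F[measurable]
    have "(\<integral>\<^sup>+\<omega>. ennreal \<bar>Y (Suc n) \<omega>\<bar> \<partial>M)
        \<le> (\<integral>\<^sup>+\<omega>. ennreal (exp (\<kappa> * S n \<omega>) * \<bar>Y n \<omega>\<bar>) + ennreal \<bar>J n \<omega>\<bar> \<partial>M)"
      by (rule nn_integral_mono)
        (auto simp: abs_mult simp flip: ennreal_plus intro!: ennreal_leI order.trans[OF abs_triangle_ineq])
    also have "\<dots> = (\<integral>\<^sup>+\<omega>. ennreal (exp (\<kappa> * S n \<omega>) * \<bar>Y n \<omega>\<bar>) \<partial>M) + (\<integral>\<^sup>+\<omega>. ennreal \<bar>J n \<omega>\<bar> \<partial>M)"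
      by (rule nn_integral_add) auto
    also have "(\<integral>\<^sup>+\<omega>. ennreal (exp (\<kappa> * S n \<omega>) * \<bar>Y n \<omega>\<bar>) \<partial>M) =
        (\<integral>\<^sup>+\<omega>. \<integral>\<^sup>+s. ennreal (exp (\<kappa> * s) * \<bar>Y n \<omega>\<bar>) \<partial>\<sigma> \<partial>M)"
      by (rule nn_integral_independent[OF subF S_measurable \<sigma>(1,2) S_indep]) auto
    also have "\<dots> = (\<integral>\<^sup>+\<omega>. ennreal \<rho> * ennreal \<bar>Y n \<omega>\<bar> \<partial>M)"
      using contraction_factor(2)
      by (auto simp: \<rho>_def ennreal_mult nn_integral_multc nn_integral_eq_integral intro!: nn_integral_cong)
    also have "\<dots> = ennreal \<rho> * (\<integral>\<^sup>+\<omega>. ennreal \<bar>Y n \<omega>\<bar> \<partial>M)"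
      by (rule nn_integral_cmult) auto
    also have "(\<integral>\<^sup>+\<omega>. ennreal \<bar>J n \<omega>\<bar> \<partial>M) = (\<integral>\<^sup>+\<omega>. \<integral>\<^sup>+v. ennreal \<bar>v\<bar> \<partial>\<nu> \<partial>M)"
      by (rule nn_integral_independent[OF subH J_measurable \<nu>(1,2) J_indep]) auto
    also have "\<dots> = ennreal m"
      using J_moment by (simp add: m_def nn_integral_eq_integral emeasure_space_1)
    also have "ennreal \<rho> * (\<integral>\<^sup>+\<omega>. ennreal \<bar>Y n \<omega>\<bar> \<partial>M) + ennreal m \<le> ennreal \<rho> * ennreal B + ennreal m"
      using Suc by (intro add_right_mono mult_left_mono) auto
    also have "\<dots> = ennreal (\<rho> * B + m)"
      using \<rho> B m by (simp add: ennreal_mult ennreal_plus)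
    also have "\<dots> \<le> ennreal B" using B by (intro ennreal_leI)
    finally show ?case .
  qed
  have int: "integrable M (Y n)" for n
    using nn[of n] by (intro integrableI_bounded) (auto simp: le_less_trans)
  have "(\<integral>\<omega>. \<bar>Y n \<omega>\<bar> \<partial>M) \<le> B" for n
    using nn[of n] nn_integral_eq_integral[of M "\<lambda>\<omega>. \<bar>Y n \<omega>\<bar>"] int[of n] B(1) by simp
  with int B show thesis by (intro that[of B]) auto
qed

text \<open>
  Suppose that the level is avoided forever with probability \<open>\<delta> > 0\<close>. By the moment bound and Markov's
  inequality, at each step the chain is still alive and at most \<open>R\<close> with probability at least \<open>\<delta> / 2\<close>,
  and from there it passes the level with probability at least \<open>tail (R - l)\<close>. So the passage
  probabilities of single steps are bounded away from \<open>0\<close>, although they are summable.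
\<close>

lemma prob_alive_tendsto_0:
  assumes tail_pos: "\<And>d. 0 < tail d"
  shows "(\<lambda>n. prob (alive l n)) \<longlonglongrightarrow> 0"
proof -
  obtain B where B: "0 \<le> B" "\<And>n. integrable M (Y n)" "\<And>n. (\<integral>\<omega>. \<bar>Y n \<omega>\<bar> \<partial>M) \<le> B"
    using Y_moment_bound by blast
  have "decseq (\<lambda>n. prob (alive l n))"
    by (rule decseq_SucI) (simp add: prob_alive_Suc)
  then obtain \<delta> where \<delta>: "(\<lambda>n. prob (alive l n)) \<longlonglongrightarrow> \<delta>" "\<And>n. \<delta> \<le> prob (alive l n)"
    using decseq_convergent[of "\<lambda>n. prob (alive l n)" 0] by (metis measure_nonneg)
  have "0 \<le> \<delta>" by (rule LIMSEQ_le_const[OF \<delta>(1)]) auto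
  have "\<not> 0 < \<delta>"
  proof
    assume "0 < \<delta>"
    \<comment> \<open>By Markov's inequality, \<open>\<bar>Y n\<bar> \<ge> R\<close> has probability at most \<open>B / R \<le> \<delta> / 2\<close>.\<close>
    define R where "R = 2 * B / \<delta> + 1"
    have R: "0 < R" "B / R \<le> \<delta> / 2"
      using \<open>0 < \<delta>\<close> B(1) by (auto simp: R_def field_simps add_pos_nonneg add_nonneg_pos)
    have hit_lower: "\<delta> / 2 * tail (R - l) \<le> prob (hit l n)" for n
    proof -
      have big: "prob {\<omega>\<in>space M. R \<le> \<bar>Y n \<omega>\<bar>} \<le> \<delta> / 2"
      proof -
        have "prob {\<omega>\<in>space M. R \<le> \<bar>Y n \<omega>\<bar>} \<le> (\<integral>\<omega>. \<bar>Y n \<omega>\<bar> \<partial>M) / R"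
          by (rule integral_Markov_inequality_measure[where A="{}"]) (use B R in auto)
        also have "\<dots> \<le> B / R" using B(3)[of n] R(1) by (simp add: divide_right_mono)
        finally show ?thesis using R(2) by linarith
      qed
      define G where "G = alive l n - {\<omega>\<in>space M. R \<le> \<bar>Y n \<omega>\<bar>}"
      have [measurable]: "G \<in> sets M" by (auto simp: G_def)
      have "prob (alive l n) - prob {\<omega>\<in>space M. R \<le> \<bar>Y n \<omega>\<bar>} \<le> prob G"
      proof -
        have "prob (alive l n) \<le> prob (G \<union> {\<omega>\<in>space M. R \<le> \<bar>Y n \<omega>\<bar>})"
          by (rule finite_measure_mono) (auto simp: G_def)
        also have "\<dots> \<le> prob G + prob {\<omega>\<in>space M. R \<le> \<bar>Y n \<omega>\<bar>}"
          by (rule measure_Un_le) auto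
        finally show ?thesis by simp
      qed
      then have "\<delta> / 2 \<le> prob G" using big \<delta>(2)[of n] by linarith
      then have "\<delta> / 2 * tail (R - l) \<le> prob G * tail (R - l)"
        by (rule mult_right_mono) (rule tail_nonneg)
      also have "\<dots> = (\<integral>\<omega>. indicator G \<omega> * tail (R - l) \<partial>M)" by simp
      also have "\<dots> \<le> (\<integral>\<omega>. indicator (alive l n) \<omega> * tail (pre_jump n \<omega> - l) \<partial>M)"
      proof (rule integral_mono_AE)
        show "integrable M (\<lambda>\<omega>. indicator (alive l n) \<omega> * tail (pre_jump n \<omega> - l))"
          using tail_measurable[of n l] tail_le_1 tail_nonneg
          by (intro integrable_const_bound[of _ 1]) (auto simp: abs_mult mult_le_one)
        show "AE \<omega> in M. indicator G \<omega> * tail (R - l) \<le> indicator (alive l n) \<omega> * tail (pre_jump n \<omega> - l)"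
          using AE_S_pos[of n]
        proof eventually_elim
          case (elim \<omega>)
          show ?case
          proof (cases "\<omega> \<in> G")
            case True
            then have g: "\<omega> \<in> alive l n" "\<bar>Y n \<omega>\<bar> < R" by (auto simp: G_def alive_def)
            have "exp (\<kappa> * S n \<omega>) \<le> 1" using elim decay by (auto simp: mult_nonpos_nonneg)
            then have "exp (\<kappa> * S n \<omega>) * \<bar>Y n \<omega>\<bar> \<le> 1 * \<bar>Y n \<omega>\<bar>"
              by (rule mult_right_mono) simp
            moreover have "pre_jump n \<omega> \<le> exp (\<kappa> * S n \<omega>) * \<bar>Y n \<omega>\<bar>"
              unfolding pre_jump_def by (rule mult_left_mono) auto
            ultimately have "pre_jump n \<omega> \<le> \<bar>Y n \<omega>\<bar>" by linarith
            then show ?thesis using g True by (auto intro!: tail_antimono)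
          qed (auto simp: tail_nonneg)
        qed
      qed (auto intro!: integrable_const_bound[of _ 1] mult_le_one simp: abs_mult tail_nonneg tail_le_1)
      finally show ?thesis by (simp add: prob_hit)
    qed
    have "(\<lambda>n. prob (alive l n) - prob (alive l (Suc n))) \<longlonglongrightarrow> \<delta> - \<delta>"
      by (intro tendsto_diff \<delta> LIMSEQ_Suc)
    then have "(\<lambda>n. prob (hit l n)) \<longlonglongrightarrow> 0" by (simp add: prob_alive_Suc)
    then have "\<delta> / 2 * tail (R - l) \<le> 0"
      by (rule LIMSEQ_le_const) (use hit_lower in auto)
    then show False using \<open>0 < \<delta>\<close> tail_pos[of "R - l"] by (simp add: mult_le_0_iff)
  qed
  with \<open>0 \<le> \<delta>\<close> \<delta>(1) show ?thesis by simp
qed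


definition near_miss :: "real \<Rightarrow> real \<Rightarrow> nat \<Rightarrow> 'a set" where
  "near_miss l C n = {\<omega>\<in>alive l n. pre_jump n \<omega> < l + C}"

lemma near_miss_sets [measurable]: "near_miss l C n \<in> sets M"
proof -
  have "near_miss l C n = alive l n \<inter> {\<omega>\<in>space M. pre_jump n \<omega> < l + C}"
    by (auto simp: near_miss_def alive_def)
  then show ?thesis by simp
qed

lemma prob_near_miss_0:
  assumes "0 \<le> x" "l + C < 0"
  shows "prob (near_miss l C 0) = 0"
proof -
  have "0 \<le> pre_jump 0 \<omega>" for \<omega> using assms by (simp add: pre_jump_def)
  then have "near_miss l C 0 = {}" using assms by (auto simp: near_miss_def not_less intro: order.trans less_imp_le)
  then show ?thesis by simp
qed

text \<open>
  A near miss requires that jump \<open>n + 1\<close> landed in \<open>(l, l + C)\<close> and that the next holding time was at most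
  \<open>\<epsilon>\<close>: a longer holding time carries every state above \<open>l\<close> past \<open>l + C\<close>. These two requirements are
  independent, and the first is at most \<open>K\<close> times as likely as landing below \<open>l\<close> at the same jump.
\<close>

lemma prob_near_miss_Suc:
  assumes l: "l < 0" "0 \<le> C" "l + C \<le> exp (\<kappa> * \<epsilon>) * l"
    and K: "\<And>d. 0 < d \<Longrightarrow> tail (d - C) \<le> K * tail d"
  shows "prob (near_miss l C (Suc n)) \<le> measure \<sigma> {..\<epsilon>} * (K * prob (hit l n))"
proof -
  define A where "A = {\<omega>\<in>alive l (Suc n). Y (Suc n) \<omega> \<le> l + C}"
  have A: "A \<in> sets (F (Suc n))"
  proof -
    note Y_measurable_F[measurable] alive_F[measurable]
    have "alive l (Suc n) \<inter> {\<omega>\<in>space (F (Suc n)). Y (Suc n) \<omega> \<le> l + C} \<in> sets (F (Suc n))"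
      by measurable
    also have "alive l (Suc n) \<inter> {\<omega>\<in>space (F (Suc n)). Y (Suc n) \<omega> \<le> l + C} = A"
      by (auto simp: A_def alive_def simp del: Y.simps)
    finally show ?thesis .
  qed
  then have AM [measurable]: "A \<in> sets M" using subF[of "Suc n"] by (auto simp: subalgebra_def)
  have "exp (\<kappa> * \<epsilon>) * l < 0" using l by (simp add: mult_pos_neg)
  then have neg: "l + C < 0" using l by linarith
  have "prob (near_miss l C (Suc n)) \<le> prob (A \<inter> (S (Suc n) -` {..\<epsilon>} \<inter> space M))"
  proof (rule finite_measure_mono_AE)
    show "AE \<omega> in M. \<omega> \<in> near_miss l C (Suc n) \<longrightarrow> \<omega> \<in> A \<inter> (S (Suc n) -` {..\<epsilon>} \<inter> space M)"
      using AE_S_pos[of "Suc n"]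
    proof eventually_elim
      case (elim \<omega>)
      define y where "y = Y (Suc n) \<omega>"
      define e where "e = exp (\<kappa> * S (Suc n) \<omega>)"
      have e: "0 < e" "e \<le> 1" using elim decay by (auto simp: e_def mult_nonpos_nonneg)
      show ?case
      proof
        assume "\<omega> \<in> near_miss l C (Suc n)"
        then have \<omega>: "\<omega> \<in> alive l (Suc n)" "\<omega> \<in> space M" "l < y" "e * y < l + C"
          by (auto simp: near_miss_def alive_def pre_jump_def y_def e_def simp del: Y.simps)
        have "e * y < 0" using \<omega> neg by linarith
        then have "y < 0" using e by (simp add: mult_less_0_iff)
        then have "1 * y \<le> e * y" using e by (intro mult_right_mono_neg) auto
        then have "y \<le> l + C" using \<omega> by linarith
        moreover have "e * l < exp (\<kappa> * \<epsilon>) * l"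
        proof -
          have "e * l < e * y" using \<omega> e by simp
          then show ?thesis using \<omega> l by linarith
        qed
        then have "exp (\<kappa> * \<epsilon>) < e" using l(1) by simp
        then have "\<kappa> * \<epsilon> < \<kappa> * S (Suc n) \<omega>" by (simp add: e_def)
        then have "S (Suc n) \<omega> \<le> \<epsilon>" using decay by simp
        ultimately show "\<omega> \<in> A \<inter> (S (Suc n) -` {..\<epsilon>} \<inter> space M)"
          using \<omega> by (auto simp: A_def y_def simp del: Y.simps)
      qed
    qed
  qed simp
  also have "\<dots> = prob A * measure \<sigma> {..\<epsilon>}"
    by (rule S_indep[OF A]) simp
  also have "prob A \<le> K * prob (hit l n)"
  proof -
    have "prob A \<le> prob {\<omega>\<in>alive l n. Y (Suc n) \<omega> \<le> l + C}"
    proof (rule finite_measure_mono)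
      have "alive l n \<inter> {\<omega>\<in>space M. Y (Suc n) \<omega> \<le> l + C} \<in> sets M"
        using Y_measurable[of "Suc n"] by (simp del: Y.simps)
      also have "alive l n \<inter> {\<omega>\<in>space M. Y (Suc n) \<omega> \<le> l + C} = {\<omega>\<in>alive l n. Y (Suc n) \<omega> \<le> l + C}"
        by (auto simp: alive_def simp del: Y.simps)
      finally show "{\<omega>\<in>alive l n. Y (Suc n) \<omega> \<le> l + C} \<in> sets M" .
    qed (auto simp: A_def alive_def simp del: Y.simps)
    also have "\<dots> = (\<integral>\<omega>. indicator (alive l n) \<omega> * tail (pre_jump n \<omega> - (l + C)) \<partial>M)"
      by (rule prob_jump_below[OF alive_H])
    also have "\<dots> \<le> (\<integral>\<omega>. K * (indicator (alive l n) \<omega> * tail (pre_jump n \<omega> - l)) \<partial>M)"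
    proof (rule integral_mono_AE)
      show "integrable M (\<lambda>\<omega>. indicator (alive l n) \<omega> * tail (pre_jump n \<omega> - (l + C)))"
        "integrable M (\<lambda>\<omega>. K * (indicator (alive l n) \<omega> * tail (pre_jump n \<omega> - l)))"
        using tail_measurable[of n l] tail_measurable[of n "l + C"] tail_le_1 tail_nonneg
        by (auto intro!: integrable_mult_right integrable_const_bound[of _ 1] simp: abs_mult mult_le_one)
      show "AE \<omega> in M. indicator (alive l n) \<omega> * tail (pre_jump n \<omega> - (l + C))
          \<le> K * (indicator (alive l n) \<omega> * tail (pre_jump n \<omega> - l))"
        using alive_pre_gt[OF l(1), of n]
      proof eventually_elim
        case (elim \<omega>)
        then show ?case using K[of "pre_jump n \<omega> - l"] by (auto simp: indicator_def algebra_simps)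
      qed
    qed
    also have "\<dots> = K * prob (hit l n)" by (simp add: prob_hit)
    finally show ?thesis .
  qed
  then have "prob A * measure \<sigma> {..\<epsilon>} \<le> (K * prob (hit l n)) * measure \<sigma> {..\<epsilon>}"
    by (rule mult_right_mono) simp
  finally show ?thesis by (simp add: mult.commute)
qed

definition chain_undershoot :: "real \<Rightarrow> 'a \<Rightarrow> real" where
  "chain_undershoot l \<omega> = l - Y (LEAST n. Y n \<omega> \<le> l) \<omega>"

lemma chain_undershoot_measurable [measurable]: "chain_undershoot l \<in> borel_measurable M"
proof -
  have "(\<lambda>\<omega>. Y (LEAST n. Y n \<omega> \<le> l) \<omega>) \<in> borel_measurable M"
    by (rule measurable_compose_countable[where g="\<lambda>\<omega>. LEAST n. Y n \<omega> \<le> l"]) auto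
  then show ?thesis unfolding chain_undershoot_def by simp
qed

lemma AE_passage:
  assumes tail_pos: "\<And>d. 0 < tail d"
  shows "AE \<omega> in M. \<exists>n. Y n \<omega> \<le> l"
proof -
  have "{\<omega>\<in>space M. \<not> (\<exists>n. Y n \<omega> \<le> l)} \<subseteq> alive l n" for n
    by (auto simp: alive_def not_le)
  then have "prob {\<omega>\<in>space M. \<not> (\<exists>n. Y n \<omega> \<le> l)} \<le> prob (alive l n)" for n
    by (intro finite_measure_mono) auto
  then have "prob {\<omega>\<in>space M. \<not> (\<exists>n. Y n \<omega> \<le> l)} \<le> 0"
    by (intro LIMSEQ_le_const[OF prob_alive_tendsto_0[OF tail_pos, of l]]) auto
  then have "prob {\<omega>\<in>space M. \<not> (\<exists>n. Y n \<omega> \<le> l)} = 0" by (simp add: measure_le_0_iff)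
  then show ?thesis
    by (subst AE_iff_measurable[OF _ refl]) (auto simp: emeasure_eq_measure)
qed

lemma sums_prob_hit:
  assumes tail_pos: "\<And>d. 0 < tail d" and "l < x"
  shows "(\<lambda>n. prob (hit l n)) sums 1"
proof -
  have "(\<lambda>n. prob (alive l n) - prob (alive l (Suc n))) sums (prob (alive l 0) - 0)"
    by (rule telescope_sums'[OF prob_alive_tendsto_0[OF tail_pos]])
  moreover have "alive l 0 = space M" using \<open>l < x\<close> by (auto simp: alive_def)
  ultimately show ?thesis by (simp add: prob_alive_Suc prob_space)
qed

text \<open>
  The decomposition of the transform according to the index of the jump that passes the level.
\<close>

lemma sums_chain_undershoot:
  assumes tail_pos: "\<And>d. 0 < tail d" and "l < x" "0 \<le> \<zeta>"
  shows "(\<lambda>n. \<integral>\<omega>. indicator (alive l n) \<omega> * excess_laplace \<zeta> (pre_jump n \<omega> - l) \<partial>M)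
     sums (\<integral>\<omega>. exp (- \<zeta> * chain_undershoot l \<omega>) \<partial>M)"
proof -
  define f where "f n \<omega> = indicator (hit l n) \<omega> * exp (- \<zeta> * (l - Y (Suc n) \<omega>))" for n \<omega>
  have f_bd: "0 \<le> f n \<omega>" "f n \<omega> \<le> indicator (hit l n) \<omega>" for n \<omega>
    using \<open>0 \<le> \<zeta>\<close> by (auto simp: f_def hit_def indicator_def simp del: Y.simps)
  have f_meas [measurable]: "f n \<in> borel_measurable M" for n
    unfolding f_def using Y_measurable[of "Suc n"] by (simp del: Y.simps)
  have f_int: "integrable M (f n)" for n
    by (rule integrable_const_bound[of _ 1])
      (use f_bd in \<open>auto intro: order.trans[OF f_bd(2)] simp: indicator_def\<close>)
  have f_sums: "(\<lambda>n. f n \<omega>) sums exp (- \<zeta> * chain_undershoot l \<omega>)"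
    if "\<omega> \<in> space M" "\<exists>n. Y n \<omega> \<le> l" for \<omega>
  proof -
    define m where "m = (LEAST n. Y n \<omega> \<le> l)"
    have m: "Y m \<omega> \<le> l" "\<And>i. i < m \<Longrightarrow> l < Y i \<omega>"
      using LeastI_ex[OF that(2)] not_less_Least[of _ "\<lambda>n. Y n \<omega> \<le> l"] by (auto simp: m_def not_le)
    then obtain k where k: "m = Suc k" using \<open>l < x\<close> by (cases m) auto
    have "f n \<omega> = (if n = k then exp (- \<zeta> * chain_undershoot l \<omega>) else 0)" for n
    proof (cases n k rule: linorder_cases)
      case less
      then show ?thesis using m(2)[of "Suc n"] by (auto simp: f_def hit_def k simp del: Y.simps)
    next
      case equal
      then have "\<omega> \<in> hit l n" using m that by (auto simp: hit_def alive_def k simp del: Y.simps)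
      then show ?thesis using equal by (simp add: f_def chain_undershoot_def k flip: m_def del: Y.simps)
    next
      case greater
      then have "\<omega> \<notin> hit l n"
        using m(1) by (auto simp: hit_def alive_def k not_less simp del: Y.simps intro!: exI[of _ "Suc k"])
      then show ?thesis using greater by (simp add: f_def)
    qed
    then have "(\<lambda>n. f n \<omega>) = (\<lambda>n. if n = k then exp (- \<zeta> * chain_undershoot l \<omega>) else 0)" by (rule ext)
    then show ?thesis using sums_single[of k "\<lambda>_. exp (- \<zeta> * chain_undershoot l \<omega>)"] by (simp only:)
  qed
  note passage = AE_passage[OF tail_pos, of l]
  have summ: "summable (\<lambda>n. \<integral>\<omega>. norm (f n \<omega>) \<partial>M)"
  proof (rule summable_comparison_test')
    show "summable (\<lambda>n. prob (hit l n))"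
      using sums_prob_hit[OF tail_pos \<open>l < x\<close>] by (rule sums_summable)
    show "norm (\<integral>\<omega>. norm (f n \<omega>) \<partial>M) \<le> prob (hit l n)" for n
    proof -
      have "(\<integral>\<omega>. norm (f n \<omega>) \<partial>M) \<le> (\<integral>\<omega>. indicator (hit l n) \<omega> \<partial>M)"
      proof (rule integral_mono)
        show "integrable M (indicator (hit l n) :: 'a \<Rightarrow> real)"
          by (rule integrable_const_bound[of _ 1]) auto
      qed (use f_bd f_int in auto)
      then show ?thesis by simp
    qed
  qed
  have "(\<lambda>n. \<integral>\<omega>. f n \<omega> \<partial>M) sums (\<integral>\<omega>. (\<Sum>n. f n \<omega>) \<partial>M)"
  proof (rule sums_integral[OF f_int _ summ])
    show "AE \<omega> in M. summable (\<lambda>n. norm (f n \<omega>))"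
      using passage AE_space
    proof eventually_elim
      case (elim \<omega>)
      then show ?case using f_sums[of \<omega>] f_bd(1) by (simp add: sums_summable)
    qed
  qed
  also have "(\<integral>\<omega>. (\<Sum>n. f n \<omega>) \<partial>M) = (\<integral>\<omega>. exp (- \<zeta> * chain_undershoot l \<omega>) \<partial>M)"
  proof (rule integral_cong_AE)
    show "AE \<omega> in M. (\<Sum>n. f n \<omega>) = exp (- \<zeta> * chain_undershoot l \<omega>)"
      using passage AE_space by eventually_elim (rule sums_unique[symmetric, OF f_sums])
  qed auto
  finally show ?thesis
    using jump_below_laplace(2)[OF alive_H \<open>0 \<le> \<zeta>\<close>, of l _ l] unfolding f_def hit_def by simp
qed

text \<open>
  Step by step, passage from distance at least \<open>C\<close> contributes an error of at most \<open>\<delta>\<close> times the passage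
  probability, and passage from a smaller distance at most the probability of a near miss. The passage
  probabilities sum to \<open>1\<close>.
\<close>

lemma hitting_error:
  assumes tail_pos: "\<And>d. 0 < tail d" and "0 \<le> x" "0 \<le> \<zeta>" "0 \<le> \<theta>" "\<theta> \<le> 1"
    and l: "l < 0" "0 \<le> C" "l + C \<le> exp (\<kappa> * \<epsilon>) * l"
    and K: "\<And>d. 0 < d \<Longrightarrow> tail (d - C) \<le> K * tail d"
    and \<delta>: "0 \<le> \<delta>" "\<And>d. C \<le> d \<Longrightarrow> \<bar>excess_laplace \<zeta> d - \<theta> * tail d\<bar> \<le> \<delta> * tail d"
  shows "\<bar>(\<integral>\<omega>. exp (- \<zeta> * chain_undershoot l \<omega>) \<partial>M) - \<theta>\<bar> \<le> \<delta> + measure \<sigma> {..\<epsilon>} * K"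
proof -
  define a where "a n = (\<integral>\<omega>. indicator (alive l n) \<omega> * excess_laplace \<zeta> (pre_jump n \<omega> - l) \<partial>M)" for n
  define b where "b n = prob (hit l n)" for n
  \<comment> \<open>The initial state is not below \<open>0\<close>, so there is no near miss at the first jump.\<close>
  define e where "e n = (case n of 0 \<Rightarrow> 0 | Suc k \<Rightarrow> measure \<sigma> {..\<epsilon>} * (K * b k))" for n
  have lx: "l < x" using l \<open>0 \<le> x\<close> by linarith
  have "exp (\<kappa> * \<epsilon>) * l < 0" using l by (simp add: mult_pos_neg)
  then have neg: "l + C < 0" using l by linarith
  have near_miss_le: "prob (near_miss l C n) \<le> e n" for n
    using prob_near_miss_0[OF \<open>0 \<le> x\<close> neg] prob_near_miss_Suc[OF l K]
    by (cases n) (simp_all add: e_def b_def)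
  have err: "\<bar>a n - \<theta> * b n\<bar> \<le> \<delta> * b n + e n" for n
  proof -
    have lap_le: "excess_laplace \<zeta> d \<le> 1" for d
      using excess_laplace_bounds(2)[OF \<open>0 \<le> \<zeta>\<close>] tail_le_1 by (rule order.trans)
    have int: "integrable M (\<lambda>\<omega>. indicator (alive l n) \<omega> * excess_laplace \<zeta> (pre_jump n \<omega> - l))"
      "integrable M (\<lambda>\<omega>. indicator (alive l n) \<omega> * tail (pre_jump n \<omega> - l))"
      "integrable M (\<lambda>\<omega>. indicator (near_miss l C n) \<omega> :: real)"
      using tail_measurable[of n l] jump_below_laplace(1)[OF alive_H \<open>0 \<le> \<zeta>\<close>, of n l]
        tail_le_1 tail_nonneg excess_laplace_bounds(1)[OF \<open>0 \<le> \<zeta>\<close>] lap_le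
      by (auto intro!: integrable_const_bound[of _ 1] simp: abs_mult split: split_indicator)
    have "\<bar>a n - \<theta> * b n\<bar> = \<bar>\<integral>\<omega>. indicator (alive l n) \<omega> * excess_laplace \<zeta> (pre_jump n \<omega> - l)
       - \<theta> * (indicator (alive l n) \<omega> * tail (pre_jump n \<omega> - l)) \<partial>M\<bar>"
      using int by (simp add: a_def b_def prob_hit)
    also have "\<dots> \<le> (\<integral>\<omega>. \<bar>indicator (alive l n) \<omega> * excess_laplace \<zeta> (pre_jump n \<omega> - l)
       - \<theta> * (indicator (alive l n) \<omega> * tail (pre_jump n \<omega> - l))\<bar> \<partial>M)"
      by (rule integral_abs_bound)
    also have "\<dots> \<le> (\<integral>\<omega>. \<delta> * (indicator (alive l n) \<omega> * tail (pre_jump n \<omega> - l)) + indicator (near_miss l C n) \<omega> \<partial>M)"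
    proof (rule integral_mono)
      fix \<omega> assume "\<omega> \<in> space M"
      define d where "d = pre_jump n \<omega> - l"
      show "\<bar>indicator (alive l n) \<omega> * excess_laplace \<zeta> (pre_jump n \<omega> - l)
         - \<theta> * (indicator (alive l n) \<omega> * tail (pre_jump n \<omega> - l))\<bar>
         \<le> \<delta> * (indicator (alive l n) \<omega> * tail (pre_jump n \<omega> - l)) + indicator (near_miss l C n) \<omega>"
      proof (cases "\<omega> \<in> alive l n")
        case alive: True
        show ?thesis
        proof (cases "C \<le> d")
          case True
          then show ?thesis using alive \<delta>(2)[of d]
            by (auto simp: d_def indicator_def intro: order.trans)
        next
          case False
          then have "\<omega> \<in> near_miss l C n" using alive by (auto simp: near_miss_def d_def)
          moreover have "\<theta> * tail d \<le> 1" "0 \<le> \<theta> * tail d" "0 \<le> \<delta> * tail d"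
            using \<open>0 \<le> \<theta>\<close> \<open>\<theta> \<le> 1\<close> tail_le_1[of d] tail_nonneg[of d] \<open>0 \<le> \<delta>\<close> by (auto intro: mult_le_one)
          ultimately show ?thesis
            using alive excess_laplace_bounds[OF \<open>0 \<le> \<zeta>\<close>, of d] tail_le_1[of d]
            by (simp add: flip: d_def)
        qed
      qed (auto simp: indicator_def)
    qed (use int in auto)
    also have "\<dots> = \<delta> * b n + prob (near_miss l C n)"
      using int by (simp add: b_def prob_hit)
    finally show ?thesis using near_miss_le[of n] by linarith
  qed
  have a: "a sums (\<integral>\<omega>. exp (- \<zeta> * chain_undershoot l \<omega>) \<partial>M)"
    unfolding a_def by (rule sums_chain_undershoot[OF tail_pos lx \<open>0 \<le> \<zeta>\<close>])
  have b: "b sums 1" unfolding b_def by (rule sums_prob_hit[OF tail_pos lx])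
  have e: "e sums (measure \<sigma> {..\<epsilon>} * K)"
  proof -
    have "(\<lambda>k. measure \<sigma> {..\<epsilon>} * (K * b k)) sums (measure \<sigma> {..\<epsilon>} * (K * 1))"
      by (intro sums_mult b)
    then show ?thesis
      using sums_Suc_iff[of e "measure \<sigma> {..\<epsilon>} * K"] by (simp add: e_def)
  qed
  have up: "(\<lambda>n. \<theta> * b n + (\<delta> * b n + e n)) sums (\<theta> * 1 + (\<delta> * 1 + measure \<sigma> {..\<epsilon>} * K))"
    and lo: "(\<lambda>n. \<theta> * b n - (\<delta> * b n + e n)) sums (\<theta> * 1 - (\<delta> * 1 + measure \<sigma> {..\<epsilon>} * K))"
    by (intro sums_add sums_diff sums_mult b e)+
  have ub: "a n \<le> \<theta> * b n + (\<delta> * b n + e n)" and lb: "\<theta> * b n - (\<delta> * b n + e n) \<le> a n" for n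
    using err[of n] by linarith+
  show ?thesis using sums_le[OF ub a up] sums_le[OF lb lo a] by simp
qed

lemma holding_cdf_tendsto_0:
  assumes "0 < \<eta>"
  obtains \<epsilon> where "0 < \<epsilon>" "measure \<sigma> {..\<epsilon>} < \<eta>"
proof -
  have "(\<lambda>n. measure \<sigma> {..1 / real (Suc n)}) \<longlonglongrightarrow> measure \<sigma> (\<Inter>n. {..1 / real (Suc n)})"
  proof (rule \<sigma>.finite_Lim_measure_decseq)
    show "decseq (\<lambda>n. {..1 / real (Suc n)})"
      by (intro decseq_SucI) (auto intro!: order.trans[OF _ divide_left_mono] simp: field_simps)
  qed (auto simp: \<sigma>(2))
  also have "measure \<sigma> (\<Inter>n. {..1 / real (Suc n)}) = 0"
  proof -
    have "(\<Inter>n. {..1 / real (Suc n)}) = {s\<in>space \<sigma>. \<not> 0 < s}"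
    proof -
      have "s \<le> 0" if "\<And>n. s \<le> 1 / real (Suc n)" for s
        by (rule LIMSEQ_le_const[OF LIMSEQ_Suc[OF lim_1_over_n]]) (use that in auto)
      moreover have "s \<le> 1 / real (Suc n)" if "s \<le> 0" for s n
        by (rule order.trans[OF that]) auto
      ultimately show ?thesis by (auto simp: not_less sets_eq_imp_space_eq[OF \<sigma>(2)])
    qed
    moreover have "\<sigma>.prob {s\<in>space \<sigma>. \<not> 0 < s} = 0"
      using \<sigma>(3) by (subst \<sigma>.prob_Collect_eq_0) auto
    ultimately show ?thesis by simp
  qed
  finally have "eventually (\<lambda>n. measure \<sigma> {..1 / real (Suc n)} < \<eta>) sequentially"
    using \<open>0 < \<eta>\<close> by (rule order_tendstoD)
  then obtain n where "measure \<sigma> {..1 / real (Suc n)} < \<eta>"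
    by (auto simp: eventually_sequentially)
  then show thesis by (intro that[of "1 / real (Suc n)"]) auto
qed

text \<open>
  The limit of the undershoot law is the limit of the excess law of a single jump over a distant level,
  for any jump law whose tail is positive and changes by at most a constant factor under a shift.
\<close>

theorem undershoot_limit:
  assumes tail_pos: "\<And>d. 0 < tail d"
    and tail_shift: "\<And>C. 0 \<le> C \<Longrightarrow> \<exists>K. \<forall>d>0. tail (d - C) \<le> K * tail d"
    and ratio: "((\<lambda>d. excess_laplace \<zeta> d / tail d) \<longlongrightarrow> \<theta>) at_top"
    and "0 \<le> x" "0 \<le> \<zeta>"
  shows "((\<lambda>l. \<integral>\<omega>. exp (- \<zeta> * chain_undershoot l \<omega>) \<partial>M) \<longlongrightarrow> \<theta>) at_bot"
proof (rule tendstoI)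
  fix \<eta> :: real assume "0 < \<eta>"
  have \<theta>: "0 \<le> \<theta>" "\<theta> \<le> 1"
    using excess_laplace_bounds[OF \<open>0 \<le> \<zeta>\<close>] tail_pos
    by (auto intro!: tendsto_lowerbound[OF ratio] tendsto_upperbound[OF ratio] always_eventually
        simp: less_imp_le)
  have "eventually (\<lambda>d. dist (excess_laplace \<zeta> d / tail d) \<theta> < \<eta> / 3) at_top"
    using ratio \<open>0 < \<eta>\<close> by (intro tendstoD) auto
  then obtain C0 where C0: "\<And>d. C0 \<le> d \<Longrightarrow> dist (excess_laplace \<zeta> d / tail d) \<theta> < \<eta> / 3"
    by (auto simp: eventually_at_top_linorder)
  define C where "C = max C0 0"
  have C: "0 \<le> C" "\<bar>excess_laplace \<zeta> d - \<theta> * tail d\<bar> \<le> \<eta> / 3 * tail d" if "C \<le> d" for d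
  proof -
    show "0 \<le> C" by (simp add: C_def)
    have "\<bar>excess_laplace \<zeta> d / tail d - \<theta>\<bar> * tail d \<le> \<eta> / 3 * tail d"
      using C0[of d] that tail_pos[of d] by (intro mult_right_mono) (auto simp: C_def dist_real_def)
    also have "\<bar>excess_laplace \<zeta> d / tail d - \<theta>\<bar> * tail d = \<bar>(excess_laplace \<zeta> d / tail d - \<theta>) * tail d\<bar>"
      using tail_pos[of d] by (simp add: abs_mult)
    also have "(excess_laplace \<zeta> d / tail d - \<theta>) * tail d = excess_laplace \<zeta> d - \<theta> * tail d"
      using tail_pos[of d] by (simp add: field_simps)
    finally show "\<bar>excess_laplace \<zeta> d - \<theta> * tail d\<bar> \<le> \<eta> / 3 * tail d" .
  qed
  obtain K0 where "\<forall>d>0. tail (d - C) \<le> K0 * tail d" using tail_shift[OF C(1)[OF order_refl]] by blast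
  moreover define K where "K = max K0 1"
  ultimately have K: "0 < K" "\<And>d. 0 < d \<Longrightarrow> tail (d - C) \<le> K * tail d"
    using tail_nonneg by (auto intro: order.trans[OF _ mult_right_mono])
  obtain \<epsilon> where \<epsilon>: "0 < \<epsilon>" "measure \<sigma> {..\<epsilon>} < \<eta> / 3 / K"
    using holding_cdf_tendsto_0[of "\<eta> / 3 / K"] \<open>0 < \<eta>\<close> K by auto
  \<comment> \<open>Below \<open>l0\<close> a holding time of length \<open>\<epsilon>\<close> lifts the state from \<open>l\<close> to at least \<open>l + C\<close>.\<close>
  define l0 where "l0 = - C / (1 - exp (\<kappa> * \<epsilon>))"
  have q: "exp (\<kappa> * \<epsilon>) < 1" using \<epsilon> decay by (simp add: mult_neg_pos)
  have "eventually (\<lambda>l. l < min l0 0) at_bot" using eventually_at_bot_dense by blast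
  then show "eventually (\<lambda>l. dist (\<integral>\<omega>. exp (- \<zeta> * chain_undershoot l \<omega>) \<partial>M) \<theta> < \<eta>) at_bot"
  proof eventually_elim
    case (elim l)
    have l: "l < 0" "l + C \<le> exp (\<kappa> * \<epsilon>) * l"
      using elim q by (auto simp: l0_def field_simps)
    have "\<bar>(\<integral>\<omega>. exp (- \<zeta> * chain_undershoot l \<omega>) \<partial>M) - \<theta>\<bar> \<le> \<eta> / 3 + measure \<sigma> {..\<epsilon>} * K"
      using tail_pos \<open>0 \<le> x\<close> \<open>0 \<le> \<zeta>\<close> \<theta> l C K(2) \<open>0 < \<eta>\<close> by (intro hitting_error[of _ _ _ C]) auto
    also have "measure \<sigma> {..\<epsilon>} * K < \<eta> / 3" using \<epsilon>(2) K(1) by (simp add: field_simps)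
    finally show ?case using \<open>0 < \<eta>\<close> by (simp add: dist_real_def)
  qed
qed

end

section \<open>Jumps with hyperexponential tails\<close>

lemma exponential_tail_laplace:
  fixes m \<zeta> d :: real
  assumes "0 < m" "0 \<le> \<zeta>"
  shows "has_bochner_integral lborel (\<lambda>v. indicator {..- d} v * exp (\<zeta> * (d + v)) * (m * exp (m * v)))
    (m / (m + \<zeta>) * exp (- m * d))"
proof (rule has_bochner_integral_nn_integral)
  have mz: "0 < m + \<zeta>" using assms by simp
  define c where "c = m / (m + \<zeta>) * exp (- m * d)"
  have "(\<integral>\<^sup>+v. ennreal (indicator {..- d} v * exp (\<zeta> * (d + v)) * (m * exp (m * v))) \<partial>lborel) =
    (\<integral>\<^sup>+w. ennreal (indicator {..- d} (- d + - 1 * w) * exp (\<zeta> * (d + (- d + - 1 * w)))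
       * (m * exp (m * (- d + - 1 * w)))) \<partial>lborel)"
    by (subst nn_integral_real_affine[where c="- 1" and t="- d"]) (auto simp del: ennreal_mult'')
  also have "\<dots> = (\<integral>\<^sup>+w. ennreal (m * exp (- m * d) * exp (- ((m + \<zeta>) * w))) * indicator {0..} w \<partial>lborel)"
    by (intro nn_integral_cong) (auto simp: indicator_def algebra_simps simp flip: exp_add)
  also have "\<dots> = 0 - (- c * exp (- ((m + \<zeta>) * 0)))"
  proof (rule nn_integral_FTC_atLeast)
    show "((\<lambda>w. - c * exp (- ((m + \<zeta>) * w))) \<longlongrightarrow> 0) at_top"
      using mz by real_asymp
    show "DERIV (\<lambda>w. - c * exp (- ((m + \<zeta>) * w))) w :> m * exp (- m * d) * exp (- ((m + \<zeta>) * w))" for w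
    proof -
      have "DERIV (\<lambda>w. - c * exp (- ((m + \<zeta>) * w))) w :> c * (m + \<zeta>) * exp (- ((m + \<zeta>) * w))"
        by (auto intro!: derivative_eq_intros) (simp add: algebra_simps)
      also have "c * (m + \<zeta>) = m * exp (- m * d)" using mz by (simp add: c_def)
      finally show ?thesis .
    qed
  qed (use assms in auto)
  finally show "(\<integral>\<^sup>+v. ennreal (indicator {..- d} v * exp (\<zeta> * (d + v)) * (m * exp (m * v))) \<partial>lborel)
    = ennreal (m / (m + \<zeta>) * exp (- m * d))"
    by (simp add: c_def)
qed (use assms in auto)

lemma exponential_mean_integrable:
  fixes m :: real
  assumes "0 < m"
  shows "integrable lborel (\<lambda>u. if 0 < u then m * exp (- m * u) * u else 0)"
proof -
  have "integrable lborel (\<lambda>x. exponential_density m x * x ^ 1)"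
  proof (rule integrableI_nn_integral_finite)
    show "(\<integral>\<^sup>+x. ennreal (exponential_density m x * x ^ 1) \<partial>lborel) = ennreal (1 / m)"
      using nn_integral_erlang_ith_moment[OF assms, of 0 1] by simp
  qed (use assms in \<open>auto simp: exponential_density_def\<close>)
  then show ?thesis
    by (rule Bochner_Integration.integrable_cong[THEN iffD1, rotated -1])
      (auto simp: exponential_density_def mult.commute)
qed

lemma hyperexp_mean_integrable:
  assumes "\<And>k. k \<in> {1..r} \<Longrightarrow> 0 < m k"
  shows "integrable lborel (\<lambda>u. hyperexp_density r a m u * u)"
proof -
  have "integrable lborel (\<lambda>u. \<Sum>k=1..r. a k * (if 0 < u then m k * exp (- m k * u) * u else 0))"
    using assms by (intro Bochner_Integration.integrable_sum integrable_mult_right exponential_mean_integrable) auto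
  also have "(\<lambda>u. \<Sum>k=1..r. a k * (if 0 < u then m k * exp (- m k * u) * u else 0)) =
     (\<lambda>u. hyperexp_density r a m u * u)"
    by (auto simp: hyperexp_density_def fun_eq_iff sum_distrib_right mult.assoc)
  finally show ?thesis .
qed

lemma hyperexp_rates:
  assumes "hyperexp_parameters r a m"
  shows "1 \<le> r" "\<And>k. k \<in> {1..r} \<Longrightarrow> 0 < m k" "\<And>k. k \<in> {1..r} \<Longrightarrow> k \<noteq> 1 \<Longrightarrow> m 1 < m k"
proof -
  note h = assms[unfolded hyperexp_parameters_def]
  show r: "1 \<le> r" using h by (cases r) auto
  show less: "m 1 < m k" if "k \<in> {1..r}" "k \<noteq> 1" for k
    using h r that by (auto simp: strict_mono_on_def)
  show "0 < m k" if "k \<in> {1..r}" for k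
    using less[OF that] h by (cases "k = 1") auto
qed

text \<open>
  After multiplication by \<open>exp (m 1 * d)\<close> only the term with the smallest rate survives.
\<close>

lemma dominant_rate:
  fixes a m c :: "nat \<Rightarrow> real"
  assumes "1 \<le> r" "\<And>k. k \<in> {1..r} \<Longrightarrow> k \<noteq> 1 \<Longrightarrow> m 1 < m k"
  shows "((\<lambda>d. exp (m 1 * d) * (\<Sum>k=1..r. c k * exp (- m k * d))) \<longlongrightarrow> c 1) at_top"
proof -
  have "((\<lambda>d. \<Sum>k=1..r. c k * exp ((m 1 - m k) * d)) \<longlongrightarrow> (\<Sum>k=1..r. if k = 1 then c 1 else 0)) at_top"
  proof (rule tendsto_sum)
    fix k assume k: "k \<in> {1..r}"
    show "((\<lambda>d. c k * exp ((m 1 - m k) * d)) \<longlongrightarrow> (if k = 1 then c 1 else 0)) at_top"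
    proof (cases "k = 1")
      case False
      then have neg: "m 1 - m k < 0" using assms(2)[OF k] by simp
      have "((\<lambda>d. c k * exp ((m 1 - m k) * d)) \<longlongrightarrow> 0) at_top"
        using neg by real_asymp
      then show ?thesis using False by simp
    qed simp
  qed
  then show ?thesis using \<open>1 \<le> r\<close>
    by (simp add: sum_distrib_left algebra_simps flip: exp_add)
qed

locale hyperexp_jumps =
  fixes p :: real and r s :: nat and \<alpha> \<mu> \<beta> \<nu> :: "nat \<Rightarrow> real" and G :: "real measure"
  assumes p: "0 < p" "p \<le> 1"
    and params: "hyperexp_parameters r \<alpha> \<mu>" "hyperexp_parameters s \<beta> \<nu>"
    and G: "G = density lborel (\<lambda>u. ennreal (jump_density p r \<alpha> \<mu> s \<beta> \<nu> u))" "prob_space G"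
begin

sublocale prob_space G by (rule G)

lemma G_sets [simp, measurable_cong]: "sets G = sets borel"
  by (simp add: G)

lemmas rates = hyperexp_rates[OF params(1)] hyperexp_rates[OF params(2)]

lemma jump_density_nonneg: "0 \<le> jump_density p r \<alpha> \<mu> s \<beta> \<nu> u"
proof -
  have "0 \<le> hyperexp_density r \<alpha> \<mu> v" "0 \<le> hyperexp_density s \<beta> \<nu> v" for v
    using params unfolding hyperexp_parameters_def by (cases "0 < v"; auto simp: hyperexp_density_def)+
  then show ?thesis using p by (simp add: jump_density_def)
qed

lemma hyperexp_density_measurable [measurable]: "hyperexp_density n a m \<in> borel_measurable borel"
  unfolding hyperexp_density_def by measurable

lemma jump_density_measurable [measurable]: "jump_density p r \<alpha> \<mu> s \<beta> \<nu> \<in> borel_measurable borel"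
  unfolding jump_density_def by measurable

lemma integrable_abs: "integrable G (\<lambda>v. \<bar>v\<bar>)"
proof -
  have 1: "integrable lborel (\<lambda>u. hyperexp_density r \<alpha> \<mu> u * u)" "integrable lborel (\<lambda>u. hyperexp_density s \<beta> \<nu> u * u)"
    using rates by (auto intro!: hyperexp_mean_integrable)
  have "integrable lborel (\<lambda>u. hyperexp_density r \<alpha> \<mu> (0 + - 1 * u) * (0 + - 1 * u))"
    by (rule lborel_integrable_real_affine[OF 1(1)]) simp
  then have "integrable lborel (\<lambda>u. p * (hyperexp_density r \<alpha> \<mu> (- u) * - u) + (1 - p) * (hyperexp_density s \<beta> \<nu> u * u))"
    using 1(2) by simp
  also have "(\<lambda>u. p * (hyperexp_density r \<alpha> \<mu> (- u) * - u) + (1 - p) * (hyperexp_density s \<beta> \<nu> u * u)) =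
     (\<lambda>u. jump_density p r \<alpha> \<mu> s \<beta> \<nu> u * \<bar>u\<bar>)"
    by (auto simp: jump_density_def fun_eq_iff hyperexp_density_def abs_if algebra_simps)
  finally show ?thesis
    unfolding G(1) using jump_density_nonneg
    by (subst integrable_density) auto
qed

definition tail_sum :: "real \<Rightarrow> real \<Rightarrow> real" where
  "tail_sum \<zeta> d = (\<Sum>k=1..r. p * \<alpha> k * (\<mu> k / (\<mu> k + \<zeta>)) * exp (- \<mu> k * d))"

lemma laplace_below:
  assumes "0 < d" "0 \<le> \<zeta>"
  shows "(\<integral>v. indicator {..- d} v * exp (\<zeta> * (d + v)) \<partial>G) = tail_sum \<zeta> d"
proof -
  have "has_bochner_integral lborel
      (\<lambda>v. \<Sum>k=1..r. p * \<alpha> k * (indicator {..- d} v * exp (\<zeta> * (d + v)) * (\<mu> k * exp (\<mu> k * v))))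
      (\<Sum>k=1..r. p * \<alpha> k * (\<mu> k / (\<mu> k + \<zeta>) * exp (- \<mu> k * d)))"
    using rates assms
    by (intro has_bochner_integral_sum has_bochner_integral_mult_right exponential_tail_laplace) auto
  moreover have "jump_density p r \<alpha> \<mu> s \<beta> \<nu> v * (indicator {..- d} v * exp (\<zeta> * (d + v))) =
    (\<Sum>k=1..r. p * \<alpha> k * (indicator {..- d} v * exp (\<zeta> * (d + v)) * (\<mu> k * exp (\<mu> k * v))))" for v
    using assms
    by (auto simp: jump_density_def hyperexp_density_def indicator_def sum_distrib_left sum_distrib_right
        intro!: sum.cong)
  ultimately have "(\<integral>v. jump_density p r \<alpha> \<mu> s \<beta> \<nu> v * (indicator {..- d} v * exp (\<zeta> * (d + v))) \<partial>lborel)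
     = tail_sum \<zeta> d"
    by (simp add: has_bochner_integral_integral_eq tail_sum_def mult.assoc)
  then show ?thesis
    unfolding G(1) using jump_density_nonneg by (subst integral_density) auto
qed

lemma measure_below: "0 < d \<Longrightarrow> measure G {..- d} = tail_sum 0 d"
  using laplace_below[of d 0] by (simp add: sets_eq_imp_space_eq[OF G_sets])

lemma tail_sum_limit:
  assumes "0 \<le> \<zeta>"
  shows "((\<lambda>d. exp (\<mu> 1 * d) * tail_sum \<zeta> d) \<longlongrightarrow> p * \<alpha> 1 * (\<mu> 1 / (\<mu> 1 + \<zeta>))) at_top"
  unfolding tail_sum_def using rates
  by (intro dominant_rate[where c="\<lambda>k. p * \<alpha> k * (\<mu> k / (\<mu> k + \<zeta>))"]) auto

lemma \<alpha>1: "0 < \<alpha> 1" and \<mu>1: "0 < \<mu> 1"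
  using params by (auto simp: hyperexp_parameters_def)

lemma below_limit: "((\<lambda>d. exp (\<mu> 1 * d) * measure G {..- d}) \<longlongrightarrow> p * \<alpha> 1) at_top"
proof -
  have "((\<lambda>d. exp (\<mu> 1 * d) * tail_sum 0 d) \<longlongrightarrow> p * \<alpha> 1) at_top"
    using tail_sum_limit[of 0] \<mu>1 by simp
  moreover have "eventually (\<lambda>d. exp (\<mu> 1 * d) * tail_sum 0 d = exp (\<mu> 1 * d) * measure G {..- d}) at_top"
    using eventually_gt_at_top[of 0] by eventually_elim (simp add: measure_below)
  ultimately show ?thesis by (rule Lim_transform_eventually)
qed

lemma below_mono: "d \<le> d' \<Longrightarrow> measure G {..- d'} \<le> measure G {..- d}"
  by (rule finite_measure_mono) auto

text \<open>
  The weights may be negative, so positivity is not visible from the exponential sum. It holds for large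
  arguments because the leading weight is positive, and everywhere because tails are monotone.
\<close>

lemma below_pos: "0 < measure G {..- d}"
proof -
  have "eventually (\<lambda>d. 0 < exp (\<mu> 1 * d) * measure G {..- d}) at_top"
    using p \<alpha>1 by (intro order_tendstoD(1)[OF below_limit]) auto
  then have "eventually (\<lambda>d'. 0 < exp (\<mu> 1 * d') * measure G {..- d'} \<and> d \<le> d') at_top"
    using eventually_ge_at_top by (rule eventually_conj)
  then obtain d' where "0 < exp (\<mu> 1 * d') * measure G {..- d'}" "d \<le> d'"
    using eventually_happens'[OF trivial_limit_at_top_linorder] by blast
  then show ?thesis using below_mono[of d d'] by (auto simp: zero_less_mult_iff)
qed

text \<open>
  For large \<open>d\<close> the quotient of the two tails is close to \<open>exp (\<mu> 1 * C)\<close>; for the other \<open>d\<close> the left-hand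
  side is at most \<open>1\<close> and the tail on the right is bounded below.
\<close>

lemma below_shift: "\<exists>K. \<forall>d>0. measure G {..- (d - C)} \<le> K * measure G {..- d}"
proof -
  have "((\<lambda>d. exp (\<mu> 1 * (d - C)) * measure G {..- (d - C)} / (exp (\<mu> 1 * d) * measure G {..- d}))
      \<longlongrightarrow> p * \<alpha> 1 / (p * \<alpha> 1)) at_top"
    using p \<alpha>1
    by (intro tendsto_divide below_limit filterlim_compose[OF below_limit, of "\<lambda>d. d - C"])
      (auto, real_asymp)
  then have "eventually (\<lambda>d. exp (\<mu> 1 * (d - C)) * measure G {..- (d - C)} / (exp (\<mu> 1 * d) * measure G {..- d}) < 2) at_top"
    using p \<alpha>1 by (intro order_tendstoD) auto
  then obtain D where D: "\<And>d. D \<le> d \<Longrightarrow>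
      exp (\<mu> 1 * (d - C)) * measure G {..- (d - C)} / (exp (\<mu> 1 * d) * measure G {..- d}) < 2"
    by (auto simp: eventually_at_top_linorder)
  define K where "K = max (2 * exp (\<mu> 1 * C)) (1 / measure G {..- D})"
  have "measure G {..- (d - C)} \<le> K * measure G {..- d}" for d
  proof (cases "D \<le> d")
    case True
    have "exp (\<mu> 1 * (d - C)) * measure G {..- (d - C)} < 2 * (exp (\<mu> 1 * d) * measure G {..- d})"
      using D[OF True] below_pos[of d] by (subst (asm) divide_less_eq) auto
    then have "measure G {..- (d - C)} < 2 * exp (\<mu> 1 * C) * measure G {..- d}"
      by (simp add: right_diff_distrib exp_diff field_simps)
    also have "\<dots> \<le> K * measure G {..- d}" by (intro mult_right_mono) (auto simp: K_def)
    finally show ?thesis by simp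
  next
    case False
    have "measure G {..- (d - C)} \<le> 1" by simp
    also have "1 = 1 / measure G {..- D} * measure G {..- D}" using below_pos[of D] by simp
    also have "\<dots> \<le> K * measure G {..- d}"
      using False below_mono[of d D] by (intro mult_mono) (auto simp: K_def le_max_iff_disj)
    finally show ?thesis .
  qed
  then show ?thesis by blast
qed

lemma laplace_ratio:
  assumes "0 \<le> \<zeta>"
  shows "((\<lambda>d. (\<integral>v. indicator {..- d} v * exp (\<zeta> * (d + v)) \<partial>G) / measure G {..- d})
    \<longlongrightarrow> \<mu> 1 / (\<mu> 1 + \<zeta>)) at_top"
proof -
  have "((\<lambda>d. (exp (\<mu> 1 * d) * tail_sum \<zeta> d) / (exp (\<mu> 1 * d) * measure G {..- d}))
     \<longlongrightarrow> (p * \<alpha> 1 * (\<mu> 1 / (\<mu> 1 + \<zeta>))) / (p * \<alpha> 1)) at_top"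
    using p \<alpha>1 by (intro tendsto_divide tail_sum_limit below_limit assms) auto
  moreover have "eventually (\<lambda>d. (exp (\<mu> 1 * d) * tail_sum \<zeta> d) / (exp (\<mu> 1 * d) * measure G {..- d}) =
    (\<integral>v. indicator {..- d} v * exp (\<zeta> * (d + v)) \<partial>G) / measure G {..- d}) at_top"
    using eventually_gt_at_top[of 0] by eventually_elim (use assms in \<open>simp add: laplace_below\<close>)
  ultimately have "((\<lambda>d. (\<integral>v. indicator {..- d} v * exp (\<zeta> * (d + v)) \<partial>G) / measure G {..- d})
     \<longlongrightarrow> (p * \<alpha> 1 * (\<mu> 1 / (\<mu> 1 + \<zeta>))) / (p * \<alpha> 1)) at_top"
    by (rule Lim_transform_eventually)
  then show ?thesis using p \<alpha>1 by simp
qed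

end

section \<open>Paths of the linear equation driven by a counting path\<close>

definition counting_path :: "(real \<Rightarrow> nat) \<Rightarrow> bool" where
  "counting_path n \<longleftrightarrow> n 0 = 0 \<and> mono_on {0..} n \<and> (\<forall>t\<ge>0. continuous (at_right t) n)"

text \<open>
  A level that is never reached gets the value \<open>0\<close> instead of an infimum over the empty set, so that
  arrival times are nonnegative on every path.
\<close>

definition arrival :: "(real \<Rightarrow> nat) \<Rightarrow> nat \<Rightarrow> real" where
  "arrival n m = (if \<exists>t\<ge>0. m \<le> n t then Inf {t. 0 \<le> t \<and> m \<le> n t} else 0)"

lemma counting_path_mono: "counting_path n \<Longrightarrow> 0 \<le> s \<Longrightarrow> s \<le> t \<Longrightarrow> n s \<le> n t"
  by (auto simp: counting_path_def mono_on_def)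

lemma counting_path_right_constant:
  assumes "counting_path n" "0 \<le> t"
  shows "eventually (\<lambda>s. n s = n t) (at_right t)"
proof -
  have "(n \<longlongrightarrow> n t) (at_right t)"
    using assms by (auto simp: counting_path_def continuous_within)
  then show ?thesis by (simp add: tendsto_discrete)
qed

lemma arrival_nonneg: "0 \<le> arrival n m"
  by (auto simp: arrival_def intro!: cInf_greatest)

text \<open>
  Right-continuity makes the infimum a minimum.
\<close>

lemma arrival_le_iff:
  assumes n: "counting_path n" and ex: "\<exists>t\<ge>0. m \<le> n t" and "0 \<le> t"
  shows "arrival n m \<le> t \<longleftrightarrow> m \<le> n t"
proof -
  define A where "A = {t. 0 \<le> t \<and> m \<le> n t}"
  have a: "arrival n m = Inf A" using ex by (auto simp: arrival_def A_def)
  have ne: "A \<noteq> {}" and bdd: "bdd_below A"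
    using ex by (auto simp: A_def intro!: bdd_belowI[of _ 0])
  have "m \<le> n (Inf A)"
  proof (rule ccontr)
    assume less: "\<not> m \<le> n (Inf A)"
    have "eventually (\<lambda>s. n s = n (Inf A)) (at_right (Inf A))"
      by (rule counting_path_right_constant[OF n]) (use arrival_nonneg[of n m] a in simp)
    then obtain b where b: "Inf A < b" "\<And>s. Inf A < s \<Longrightarrow> s < b \<Longrightarrow> n s = n (Inf A)"
      by (auto simp: eventually_at_right_field)
    have "b \<le> u" if "u \<in> A" for u
    proof (rule ccontr)
      assume "\<not> b \<le> u"
      moreover have "Inf A \<le> u" using that bdd by (rule cInf_lower)
      moreover have "u \<noteq> Inf A" using that less by (auto simp: A_def)
      ultimately have "n u = n (Inf A)" using b(2)[of u] by auto
      then show False using that less by (auto simp: A_def)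
    qed
    then have "b \<le> Inf A" using ne by (rule cInf_greatest[rotated])
    then show False using b(1) by simp
  qed
  moreover have "n (Inf A) \<le> n t" if "Inf A \<le> t"
    using counting_path_mono[OF n _ that] arrival_nonneg[of n m] a by simp
  moreover have "Inf A \<le> t" if "m \<le> n t"
    using that \<open>0 \<le> t\<close> bdd by (intro cInf_lower) (auto simp: A_def)
  ultimately show ?thesis unfolding a by (meson order.trans)
qed

lemma arrival_0:
  assumes "counting_path n"
  shows "arrival n 0 = 0"
proof -
  have "\<exists>t\<ge>0::real. 0 \<le> n t" by (intro exI[of _ 0]) simp
  then have "arrival n 0 \<le> 0" using arrival_le_iff[OF assms, of 0 0] by simp
  then show ?thesis using arrival_nonneg[of n 0] by linarith
qed

text \<open>
  On a path with multiple jumps some levels are skipped; a level attained at some time is the level at its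
  own arrival time.
\<close>

lemma level_at_arrival:
  assumes n: "counting_path n" and "0 \<le> t"
  shows "arrival n (n t) \<le> t" "n (arrival n (n t)) = n t"
proof -
  have ex: "\<exists>u\<ge>0. n t \<le> n u" using \<open>0 \<le> t\<close> by auto
  show le: "arrival n (n t) \<le> t"
    using arrival_le_iff[OF n ex] \<open>0 \<le> t\<close> by simp
  have "n t \<le> n (arrival n (n t))"
    using arrival_le_iff[OF n ex arrival_nonneg[of n "n t"]] by simp
  then show "n (arrival n (n t)) = n t"
    using counting_path_mono[OF n arrival_nonneg le] by simp
qed

text \<open>
  While the driving path is constant, \<open>X\<close> differs from the continuous function
  \<open>t \<mapsto> integral {0..t} (\<lambda>s. \<kappa> * X s)\<close> by a constant, so it is continuous, hence differentiable, and solves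
  \<open>X' = \<kappa> X\<close>. The formula is stated for the integral and not for \<open>X\<close> because it has to hold at the right
  end point \<open>b\<close> too, where \<open>X\<close> may jump.
\<close>

lemma exponential_flow:
  fixes X :: "real \<Rightarrow> real"
  assumes ab: "0 \<le> a" "a \<le> b" and int: "X integrable_on {0..b}"
    and X: "\<And>t. a \<le> t \<Longrightarrow> t < b \<Longrightarrow> X t = integral {0..t} (\<lambda>s. \<kappa> * X s) + c"
  shows "integral {0..b} (\<lambda>s. \<kappa> * X s) + c = exp (\<kappa> * (b - a)) * (integral {0..a} (\<lambda>s. \<kappa> * X s) + c)"
proof (cases "a = b")
  case False
  then have ab': "a < b" using ab by simp
  define g where "g t = integral {0..t} (\<lambda>s. \<kappa> * X s) + c" for t
  have kint: "(\<lambda>s. \<kappa> * X s) integrable_on {0..b}"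
    using integrable_cmul[OF int, of \<kappa>] by simp
  have g_cont: "continuous_on {a..b} g"
    unfolding g_def
    by (intro continuous_intros continuous_on_subset[OF indefinite_integral_continuous_1[OF kint]])
      (use ab in auto)
  define \<phi> where "\<phi> t = exp (- \<kappa> * t) * g t" for t
  have "\<phi> b = \<phi> a"
  proof (rule DERIV_isconst_end[OF ab'])
    show "continuous_on {a..b} \<phi>" unfolding \<phi>_def by (intro continuous_intros g_cont)
    fix t assume t: "a < t" "t < b"
    have X_cont: "continuous (at t within {0..b}) X"
    proof -
      have "isCont g t" using continuous_on_interior[OF g_cont] t by simp
      moreover have "eventually (\<lambda>s. g s = X s) (at t)"
        using eventually_at_in_open'[of "{a<..<b}" t] t
        by (auto elim!: eventually_mono simp: g_def X)
      moreover have "g t = X t" using X[of t] t by (simp add: g_def)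
      ultimately have "isCont X t"
        by (auto simp: isCont_def intro: Lim_transform_eventually)
      then show ?thesis by (rule continuous_at_imp_continuous_at_within)
    qed
    have "((\<lambda>u. integral {0..u} (\<lambda>s. \<kappa> * X s)) has_vector_derivative \<kappa> * X t) (at t within {0..b})"
      using integral_has_vector_derivative_continuous_at[OF kint, of t "{}"] t ab X_cont
      by (simp add: continuous_mult)
    moreover have "at t within {0..b} = at t" using t ab by (intro at_within_interior) auto
    ultimately have "((\<lambda>u. integral {0..u} (\<lambda>s. \<kappa> * X s)) has_real_derivative \<kappa> * X t) (at t)"
      by (simp add: has_real_derivative_iff_has_vector_derivative)
    then have "((\<lambda>u. integral {0..u} (\<lambda>s. \<kappa> * X s) + c) has_real_derivative \<kappa> * X t + 0) (at t)"
      by (rule DERIV_add) (rule DERIV_const)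
    then have "(g has_real_derivative \<kappa> * g t) (at t)"
      unfolding g_def using X[of t] t by (simp del: integral_mult_right Henstock_Kurzweil_Integration.integral_mult_right)
    then show "(\<phi> has_real_derivative 0) (at t)"
      unfolding \<phi>_def by (auto intro!: derivative_eq_intros)
  qed
  then have "exp (\<kappa> * b) * \<phi> b = exp (\<kappa> * b) * \<phi> a" by simp
  then have "g b = exp (\<kappa> * (b - a)) * g a"
    by (simp add: \<phi>_def right_diff_distrib exp_diff exp_minus field_simps)
  then show ?thesis by (simp add: g_def)
qed simp

text \<open>
  A single path of the equation. Simultaneous and finitely many arrivals are not excluded, since the
  undershoot has to be expressed through the chain for every outcome in order to be measurable.
\<close>

locale jump_path =
  fixes n :: "real \<Rightarrow> nat" and v :: "nat \<Rightarrow> real" and X :: "real \<Rightarrow> real" and \<kappa> x :: real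
    and y :: "nat \<Rightarrow> real"
  assumes n: "counting_path n"
    and X_int: "\<And>t. 0 \<le> t \<Longrightarrow> X integrable_on {0..t}"
    and X_eq: "\<And>t. 0 \<le> t \<Longrightarrow> X t = x + integral {0..t} (\<lambda>s. \<kappa> * X s) + (\<Sum>i=1..n t. v i)"
    and y_0: "y 0 = x"
    and y_Suc: "\<And>j. y (Suc j) = exp (\<kappa> * (arrival n (Suc j) - arrival n j)) * y j + v (Suc j)"
begin

lemma between_arrivals:
  assumes reach: "\<exists>u\<ge>0. j \<le> n u" and b: "arrival n j \<le> b"
    and before: "\<And>t. arrival n j \<le> t \<Longrightarrow> t < b \<Longrightarrow> n t = j"
  shows "x + integral {0..b} (\<lambda>s. \<kappa> * X s) + (\<Sum>i=1..j. v i) = exp (\<kappa> * (b - arrival n j)) *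
    (x + integral {0..arrival n j} (\<lambda>s. \<kappa> * X s) + (\<Sum>i=1..j. v i))"
proof -
  have a: "0 \<le> arrival n j" by (rule arrival_nonneg)
  have "X t = integral {0..t} (\<lambda>s. \<kappa> * X s) + (x + (\<Sum>i=1..j. v i))" if "arrival n j \<le> t" "t < b" for t
    using X_eq[of t] before[OF that] a that by simp
  from exponential_flow[OF a b X_int this] a b show ?thesis by (simp add: algebra_simps)
qed

lemma state_at_arrival:
  "\<exists>u\<ge>0. j \<le> n u \<Longrightarrow> x + integral {0..arrival n j} (\<lambda>s. \<kappa> * X s) + (\<Sum>i=1..j. v i) = y j"
proof (induction j)
  case 0
  then show ?case using n by (simp add: arrival_0 y_0)
next
  case (Suc j)
  have reach: "\<exists>u\<ge>0. j \<le> n u" using Suc.prems Suc_leD by blast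
  have le: "arrival n j \<le> arrival n (Suc j)"
    using arrival_le_iff[OF n Suc.prems arrival_nonneg[of n "Suc j"]]
      arrival_le_iff[OF n reach arrival_nonneg[of n "Suc j"]] by simp
  have "n t = j" if "arrival n j \<le> t" "t < arrival n (Suc j)" for t
  proof -
    have "0 \<le> t" using that arrival_nonneg[of n j] by linarith
    then show ?thesis
      using arrival_le_iff[OF n Suc.prems] arrival_le_iff[OF n reach] that by fastforce
  qed
  from between_arrivals[OF reach le this] Suc.IH[OF reach] show ?case
    by (simp add: y_Suc)
qed

lemma X_formula:
  assumes "0 \<le> t"
  shows "X t = exp (\<kappa> * (t - arrival n (n t))) * y (n t)"
proof -
  have reach: "\<exists>u\<ge>0. n t \<le> n u" using assms by auto
  note lv = level_at_arrival[OF n assms]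
  have "n u = n t" if "arrival n (n t) \<le> u" "u < t" for u
    using counting_path_mono[OF n arrival_nonneg that(1)] lv(2)
      counting_path_mono[OF n _ less_imp_le[OF that(2)]] that arrival_nonneg[of n "n t"] by simp
  from between_arrivals[OF reach lv(1) this] state_at_arrival[OF reach] X_eq[OF assms]
  show ?thesis by simp
qed

lemma X_0: "X 0 = x"
  using X_eq[of 0] n by (simp add: counting_path_def)

lemma X_at_arrival: "0 \<le> t \<Longrightarrow> X (arrival n (n t)) = y (n t)"
  using X_formula[OF arrival_nonneg, of n "n t"] by (simp add: level_at_arrival[OF n])

text \<open>
  Until the next arrival the path runs from its value at the last arrival towards \<open>0\<close>, so if it is below
  \<open>l < 0\<close> at some time, it was so already at the last arrival. The minimum is taken over those indices
  whose level is attained; skipped indices belong to intermediate states in a multiple jump. If there is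
  no such index, the passage time is infinite and its real value is \<open>0\<close>.
\<close>

lemma passage_at_jump:
  assumes "\<kappa> \<le> 0" "l < 0" "l < x"
  shows "l - X (real_of_ereal (INF t\<in>{t. 0 < t \<and> X t \<le> l}. ereal t)) =
    (if \<exists>m. (\<exists>t\<ge>0. n t = m) \<and> y m \<le> l
     then l - y (LEAST m. (\<exists>t\<ge>0. n t = m) \<and> y m \<le> l) else l - x)"
proof -
  define P where "P m \<longleftrightarrow> (\<exists>t\<ge>0. n t = m) \<and> y m \<le> l" for m
  have below: "P (n t)" if "0 < t" "X t \<le> l" for t
  proof -
    define e where "e = exp (\<kappa> * (t - arrival n (n t)))"
    have e: "0 < e" "e \<le> 1"
      using level_at_arrival(1)[OF n, of t] that \<open>\<kappa> \<le> 0\<close> by (auto simp: e_def mult_nonpos_nonneg)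
    have X: "e * y (n t) \<le> l" using that X_formula[of t] by (simp add: e_def)
    then have "e * y (n t) < 0" using \<open>l < 0\<close> by linarith
    then have "y (n t) < 0" using e by (simp add: mult_less_0_iff)
    then have "1 * y (n t) \<le> e * y (n t)" using e by (intro mult_right_mono_neg) auto
    then show ?thesis using X that by (auto simp: P_def intro!: exI[of _ t])
  qed
  show ?thesis
  proof (cases "\<exists>m. P m")
    case False
    then have "{t. 0 < t \<and> X t \<le> l} = {}" using below by auto
    then have "(INF t\<in>{t. 0 < t \<and> X t \<le> l}. ereal t) = \<infinity>"
      by (simp only: image_empty Inf_empty top_ereal_def)
    then show ?thesis using False by (simp only: P_def X_0 if_False real_of_ereal.simps)
  next
    case True
    define m where "m = (LEAST m. P m)"
    have m: "P m" "\<And>j. P j \<Longrightarrow> m \<le> j"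
      using LeastI_ex[OF True] Least_le[of P] by (auto simp: m_def)
    then obtain u where u: "0 \<le> u" "n u = m" by (auto simp: P_def)
    define T where "T = arrival n m"
    have nT: "n T = m" and XT: "X T = y m"
      using level_at_arrival(2)[OF n u(1)] X_at_arrival[OF u(1)] u(2) by (auto simp: T_def)
    have "T \<noteq> 0"
    proof
      assume "T = 0"
      then have "m = 0" using nT n by (simp add: counting_path_def)
      then show False using m(1) y_0 \<open>l < x\<close> by (simp add: P_def)
    qed
    then have "0 < T" using arrival_nonneg[of n m] by (simp add: T_def)
    have "(INF t\<in>{t. 0 < t \<and> X t \<le> l}. ereal t) = ereal T"
    proof (rule antisym)
      show "(INF t\<in>{t. 0 < t \<and> X t \<le> l}. ereal t) \<le> ereal T"
        using \<open>0 < T\<close> XT m(1) by (intro INF_lower) (auto simp: P_def)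
      show "ereal T \<le> (INF t\<in>{t. 0 < t \<and> X t \<le> l}. ereal t)"
      proof (rule INF_greatest)
        fix t assume "t \<in> {t. 0 < t \<and> X t \<le> l}"
        then have t: "0 < t" "X t \<le> l" by auto
        have "m \<le> n t" using below[OF t] m(2) by simp
        then have "\<exists>u\<ge>0. m \<le> n u" using t by (intro exI[of _ t]) auto
        then have "T \<le> t" using arrival_le_iff[OF n, of m t] t \<open>m \<le> n t\<close> unfolding T_def by simp
        then show "ereal T \<le> ereal t" by simp
      qed
    qed
    then show ?thesis using True XT by (simp flip: P_def m_def)
  qed
qed

end

section \<open>Arrival times of a Poisson process\<close>

lemma sigma_generated_events:
  "sets (sigma (space M) {Y i -` A \<inter> space M | i A. i \<in> I \<and> A \<in> sets S}) = generated_events M I Y S"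
  unfolding generated_events_def by (rule sets_measure_of) auto

text \<open>
  The generated \<open>\<sigma>\<close>-algebra as a measure space, which makes the measurability rules applicable.
\<close>

definition history :: "'a measure \<Rightarrow> 'i set \<Rightarrow> ('i \<Rightarrow> 'a \<Rightarrow> 'b) \<Rightarrow> 'b measure \<Rightarrow> 'a measure" where
  "history M I Y S = sigma (space M) {Y i -` A \<inter> space M | i A. i \<in> I \<and> A \<in> sets S}"

lemma sets_history: "sets (history M I Y S) = generated_events M I Y S"
  unfolding history_def by (rule sigma_generated_events)

lemma space_history [simp]: "space (history M I Y S) = space M"
  unfolding history_def by (rule space_measure_of) auto

lemma history_measurable:
  assumes "i \<in> I" "Y i \<in> space M \<rightarrow> space S"
  shows "Y i \<in> history M I Y S \<rightarrow>\<^sub>M S"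
  using assms unfolding measurable_def sets_history
  by (auto simp: generated_events_def)

lemma history_mono: "I \<subseteq> J \<Longrightarrow> sets (history M I Y S) \<subseteq> sets (history M J Y S)"
  unfolding sets_history generated_events_def by (rule sigma_sets_mono') auto

lemma history_subset:
  assumes "\<And>i. i \<in> I \<Longrightarrow> Y i \<in> M \<rightarrow>\<^sub>M S"
  shows "sets (history M I Y S) \<subseteq> sets M"
  unfolding sets_history generated_events_def
  using assms by (intro sets.sigma_sets_subset) (auto intro: measurable_sets)

locale poisson_paths = prob_space M for M :: "'a measure" +
  fixes N :: "real \<Rightarrow> 'a \<Rightarrow> nat" and rate :: real
  assumes rate: "0 < rate" and process: "poisson_process M rate N"
begin

lemma N_measurable [measurable]: "0 \<le> t \<Longrightarrow> N t \<in> M \<rightarrow>\<^sub>M count_space UNIV"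
  using process by (auto simp: poisson_process_def)

lemma path: "\<omega> \<in> space M \<Longrightarrow> counting_path (\<lambda>t. N t \<omega>)"
  using process by (auto simp: poisson_process_def counting_path_def)

lemma N_mono: "\<omega> \<in> space M \<Longrightarrow> 0 \<le> s \<Longrightarrow> s \<le> t \<Longrightarrow> N s \<omega> \<le> N t \<omega>"
  using counting_path_mono[OF path] .

lemma N_0: "\<omega> \<in> space M \<Longrightarrow> N 0 \<omega> = 0"
  using process by (auto simp: poisson_process_def)

lemma increment_law:
  assumes "0 \<le> s" "s < t"
  shows "prob {\<omega>\<in>space M. N t \<omega> - N s \<omega> \<in> B} = measure (measure_pmf (poisson_pmf (rate * (t - s)))) B"
proof -
  have [measurable]: "(\<lambda>\<omega>. N t \<omega> - N s \<omega>) \<in> M \<rightarrow>\<^sub>M count_space UNIV"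
    using N_measurable[of t] N_measurable[of s] assms by simp
  have "distr M (count_space UNIV) (\<lambda>\<omega>. N t \<omega> - N s \<omega>) = measure_pmf (poisson_pmf (rate * (t - s)))"
    using process assms by (auto simp: poisson_process_def)
  then have "measure (measure_pmf (poisson_pmf (rate * (t - s)))) B =
      measure (distr M (count_space UNIV) (\<lambda>\<omega>. N t \<omega> - N s \<omega>)) B" by simp
  also have "\<dots> = prob ((\<lambda>\<omega>. N t \<omega> - N s \<omega>) -` B \<inter> space M)"
    by (rule measure_distr) auto
  also have "(\<lambda>\<omega>. N t \<omega> - N s \<omega>) -` B \<inter> space M = {\<omega>\<in>space M. N t \<omega> - N s \<omega> \<in> B}" by auto
  finally show ?thesis by simp
qed

definition no_arrival :: "real \<Rightarrow> real \<Rightarrow> 'a set" where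
  "no_arrival t \<epsilon> = {\<omega>\<in>space M. N (t + \<epsilon>) \<omega> = N t \<omega>}"

lemma no_arrival_eq:
  assumes "0 \<le> t" "0 \<le> \<epsilon>"
  shows "no_arrival t \<epsilon> = {\<omega>\<in>space M. N (t + \<epsilon>) \<omega> - N t \<omega> \<in> {0}}"
  using N_mono[of _ t "t + \<epsilon>"] assms by (force simp: no_arrival_def)

lemma no_arrival_sets [measurable]:
  assumes "0 \<le> t" "0 \<le> \<epsilon>"
  shows "no_arrival t \<epsilon> \<in> sets M"
proof -
  have [measurable]: "N (t + \<epsilon>) \<in> M \<rightarrow>\<^sub>M count_space UNIV" "N t \<in> M \<rightarrow>\<^sub>M count_space UNIV"
    using assms by auto
  show ?thesis unfolding no_arrival_eq[OF assms] by measurable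
qed

lemma prob_no_arrival:
  assumes "0 \<le> t" "0 \<le> \<epsilon>"
  shows "prob (no_arrival t \<epsilon>) = exp (- rate * \<epsilon>)"
proof (cases "\<epsilon> = 0")
  case True
  then show ?thesis by (simp add: no_arrival_def prob_space)
next
  case False
  have "prob (no_arrival t \<epsilon>) = measure (measure_pmf (poisson_pmf (rate * \<epsilon>))) {0}"
    unfolding no_arrival_eq[OF assms]
    using increment_law[of t "t + \<epsilon>" "{0}"] assms False by simp
  then show ?thesis using False assms rate by (simp add: measure_pmf_single)
qed

text \<open>
  Sorting the finitely many times, together with \<open>0\<close> and \<open>t\<close>, turns the values of the process into sums of
  increments over successive intervals up to \<open>t\<close>; these are jointly independent of the increment
  after \<open>t\<close>.
\<close>

lemma finite_past_independent:
  assumes S: "finite S" "S \<subseteq> {0..t}" and "0 \<le> t" "0 \<le> \<epsilon>"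
  shows "prob ({\<omega>\<in>space M. \<forall>s\<in>S. N s \<omega> \<in> B s} \<inter> no_arrival t \<epsilon>)
    = prob {\<omega>\<in>space M. \<forall>s\<in>S. N s \<omega> \<in> B s} * prob (no_arrival t \<epsilon>)"
proof -
  define L where "L = sorted_list_of_set (insert 0 (insert t S))"
  define k where "k = length L - 1"
  have fin: "finite (insert 0 (insert t S))" using S by simp
  have setL: "set L = insert 0 (insert t S)" and sorted: "sorted L"
    unfolding L_def using fin by (simp_all only: set_sorted_list_of_set sorted_sorted_list_of_set)
  have "L \<noteq> []" using setL by auto
  then have len: "length L = Suc k" by (simp add: k_def)
  have L0: "L ! 0 = 0"
  proof -
    obtain i where i: "i < length L" "L ! i = 0" using setL by (metis in_set_conv_nth insertI1)
    have "L ! 0 \<le> 0" using sorted_nth_mono[OF sorted, of 0 i] i by simp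
    moreover have "L ! 0 \<in> {0..t}" using nth_mem[of 0 L] len setL S \<open>0 \<le> t\<close> by auto
    ultimately show ?thesis by simp
  qed
  have Lk: "L ! k = t"
  proof -
    obtain i where i: "i < length L" "L ! i = t" using setL by (metis in_set_conv_nth insertCI)
    have "t \<le> L ! k" using sorted_nth_mono[OF sorted, of i k] i len by simp
    moreover have "L ! k \<in> {0..t}" using nth_mem[of k L] len setL S \<open>0 \<le> t\<close> by auto
    ultimately show ?thesis by simp
  qed
  \<comment> \<open>The increments before index \<open>k\<close> span the past of \<open>t\<close>; increment \<open>k\<close> is the one from \<open>t\<close> to \<open>t + \<epsilon>\<close>.\<close>
  define u where "u i = (if i \<le> k then L ! i else t + \<epsilon>)" for i
  have u_mono: "u i \<le> u j" if "i \<le> j" for i j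
  proof (cases "j \<le> k")
    case True
    then show ?thesis using sorted_nth_mono[OF sorted, of i j] that len by (simp add: u_def)
  next
    case False
    have "L ! i \<le> t" if "i \<le> k"
      using sorted_nth_mono[OF sorted, of i k] that len Lk by simp
    then show ?thesis using False \<open>0 \<le> \<epsilon>\<close> by (auto simp: u_def intro: order.trans)
  qed
  have u_nonneg: "0 \<le> u i" for i using u_mono[of 0 i] L0 by (simp add: u_def)
  define I where "I i \<omega> = N (u (Suc i)) \<omega> - N (u i) \<omega>" for i \<omega>
  have ind: "indep_vars (\<lambda>_. count_space UNIV) I {..<Suc k}"
  proof -
    have "0 \<le> u 0 \<and> mono_on {..Suc k} u" using u_nonneg u_mono by (auto simp: mono_on_def)
    then show ?thesis using process unfolding poisson_process_def I_def by blast
  qed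
  have level: "N (u j) \<omega> = (\<Sum>i<j. I i \<omega>)" if \<omega>: "\<omega> \<in> space M" for j \<omega>
  proof (induction j)
    case 0
    then show ?case using N_0[OF \<omega>] L0 by (simp add: u_def)
  next
    case (Suc j)
    have "N (u j) \<omega> \<le> N (u (Suc j)) \<omega>" using u_mono[of j "Suc j"] u_nonneg by (intro N_mono \<omega>) auto
    then show ?case using Suc by (simp add: I_def)
  qed
  define P where "P = PiM {..<k} (\<lambda>_. count_space (UNIV :: nat set))"
  have sum_meas: "j \<le> k \<Longrightarrow> (\<lambda>f. \<Sum>i<j. f i) \<in> P \<rightarrow>\<^sub>M count_space (UNIV :: nat set)" for j
  proof (induction j)
    case (Suc j)
    have "(\<lambda>f. f j) \<in> P \<rightarrow>\<^sub>M count_space UNIV"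
      unfolding P_def using Suc.prems by (intro measurable_component_singleton) auto
    then have "(\<lambda>f. i + f j) \<in> P \<rightarrow>\<^sub>M count_space UNIV" for i :: nat
      by (rule measurable_compose) simp
    from measurable_compose_countable[OF this Suc.IH] Suc.prems show ?case by simp
  qed simp
  define Xa where "Xa = {f\<in>space P. \<forall>j\<in>{..k}. L ! j \<in> S \<longrightarrow> (\<Sum>i<j. f i) \<in> B (L ! j)}"
  have Xa: "Xa \<in> sets P"
  proof -
    have "{f\<in>space P. L ! j \<in> S \<longrightarrow> (\<Sum>i<j. f i) \<in> B (L ! j)} \<in> sets P" if "j \<in> {..k}" for j
      using measurable_sets[OF sum_meas, of j "B (L ! j)"] that
      by (cases "L ! j \<in> S") (auto simp: vimage_def Int_def conj_commute)
    then show ?thesis unfolding Xa_def by (intro sets.sets_Collect_finite_All) auto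
  qed
  define Xb where "Xb = PiE {k} (\<lambda>_. {0::nat})"
  have Xb: "Xb \<in> sets (PiM {k} (\<lambda>_. count_space (UNIV :: nat set)))"
    unfolding Xb_def by (intro sets_PiM_I_finite) auto
  have "prob ((\<lambda>\<omega>. (\<lambda>i\<in>{..<k}. I i \<omega>, \<lambda>i\<in>{k}. I i \<omega>)) -` (Xa \<times> Xb) \<inter> space M) =
     prob ((\<lambda>\<omega>. \<lambda>i\<in>{..<k}. I i \<omega>) -` Xa \<inter> space M) * prob ((\<lambda>\<omega>. \<lambda>i\<in>{k}. I i \<omega>) -` Xb \<inter> space M)"
    by (rule indep_varD[OF indep_var_restrict[OF ind, of "{..<k}" "{k}"]])
      (use Xa Xb in \<open>auto simp: P_def\<close>)
  moreover have A: "(\<lambda>\<omega>. \<lambda>i\<in>{..<k}. I i \<omega>) -` Xa \<inter> space M = {\<omega>\<in>space M. \<forall>s\<in>S. N s \<omega> \<in> B s}"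
  proof -
    have "(\<lambda>i\<in>{..<k}. I i \<omega>) \<in> Xa \<longleftrightarrow> (\<forall>s\<in>S. N s \<omega> \<in> B s)" if \<omega>: "\<omega> \<in> space M" for \<omega>
    proof -
      have "(\<Sum>i<j. (\<lambda>i\<in>{..<k}. I i \<omega>) i) = N (L ! j) \<omega>" if "j \<le> k" for j
      proof -
        have "(\<Sum>i<j. (\<lambda>i\<in>{..<k}. I i \<omega>) i) = (\<Sum>i<j. I i \<omega>)"
          using that by (intro sum.cong) auto
        then show ?thesis using level[OF \<omega>, of j] that by (simp add: u_def)
      qed
      moreover have "(\<lambda>i\<in>{..<k}. I i \<omega>) \<in> space P" by (simp add: P_def space_PiM)
      ultimately have "(\<lambda>i\<in>{..<k}. I i \<omega>) \<in> Xa \<longleftrightarrow> (\<forall>j\<le>k. L ! j \<in> S \<longrightarrow> N (L ! j) \<omega> \<in> B (L ! j))"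
        by (simp add: Xa_def Ball_def)
      also have "\<dots> \<longleftrightarrow> (\<forall>s\<in>S. N s \<omega> \<in> B s)"
      proof safe
        fix s assume all: "\<forall>j\<le>k. L ! j \<in> S \<longrightarrow> N (L ! j) \<omega> \<in> B (L ! j)" and "s \<in> S"
        then obtain j where "j < length L" "L ! j = s" using setL by (metis in_set_conv_nth insertCI)
        then show "N s \<omega> \<in> B s" using all \<open>s \<in> S\<close> len by auto
      qed auto
      finally show ?thesis .
    qed
    then show ?thesis by auto
  qed
  moreover have Bk: "(\<lambda>\<omega>. \<lambda>i\<in>{k}. I i \<omega>) -` Xb \<inter> space M = no_arrival t \<epsilon>"
  proof -
    have "I k \<omega> = 0 \<longleftrightarrow> N (t + \<epsilon>) \<omega> = N t \<omega>" if "\<omega> \<in> space M" for \<omega>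
      using N_mono[OF that \<open>0 \<le> t\<close>, of "t + \<epsilon>"] \<open>0 \<le> \<epsilon>\<close> Lk by (auto simp: I_def u_def)
    moreover have "(\<lambda>i\<in>{k}. I i \<omega>) \<in> Xb \<longleftrightarrow> I k \<omega> = 0" for \<omega>
      unfolding Xb_def PiE_iff by simp
    ultimately show ?thesis unfolding no_arrival_def vimage_def by auto
  qed
  moreover have "(\<lambda>\<omega>. (\<lambda>i\<in>{..<k}. I i \<omega>, \<lambda>i\<in>{k}. I i \<omega>)) -` (Xa \<times> Xb) \<inter> space M =
     ((\<lambda>\<omega>. \<lambda>i\<in>{..<k}. I i \<omega>) -` Xa \<inter> space M) \<inter> ((\<lambda>\<omega>. \<lambda>i\<in>{k}. I i \<omega>) -` Xb \<inter> space M)"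
    by auto
  ultimately show ?thesis by simp
qed

abbreviation past :: "real \<Rightarrow> 'a measure" where
  "past t \<equiv> history M {0..t} N (count_space UNIV)"

lemma past_subset: "sets (past t) \<subseteq> sets M"
  by (rule history_subset) auto

lemma N_past [measurable]: "0 \<le> s \<Longrightarrow> s \<le> t \<Longrightarrow> N s \<in> past t \<rightarrow>\<^sub>M count_space UNIV"
  by (rule history_measurable) auto

text \<open>
  Events that constrain finitely many past values are closed under intersection and generate the past.
\<close>

lemma past_independent:
  assumes A: "A \<in> sets (past t)" and "0 \<le> t" "0 \<le> \<epsilon>"
  shows "prob (A \<inter> no_arrival t \<epsilon>) = prob A * exp (- rate * \<epsilon>)"
proof -
  define cyl where "cyl S B = {\<omega>\<in>space M. \<forall>s\<in>S. N s \<omega> \<in> B s}" for S B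
  define \<C> where "\<C> = {cyl S B | S B. finite S \<and> S \<subseteq> {0..t}}"
  have ev: "\<C> \<subseteq> events"
  proof -
    have "cyl S B \<in> events" if "finite S" "S \<subseteq> {0..t}" for S B
    proof -
      have "{\<omega>\<in>space M. N s \<omega> \<in> B s} \<in> events" if "s \<in> S" for s
      proof -
        have "N s -` B s \<inter> space M \<in> events"
          by (rule measurable_sets[OF N_measurable]) (use that \<open>S \<subseteq> {0..t}\<close> in auto)
        also have "N s -` B s \<inter> space M = {\<omega>\<in>space M. N s \<omega> \<in> B s}" by blast
        finally show ?thesis .
      qed
      then show ?thesis unfolding cyl_def using \<open>finite S\<close> by (intro sets.sets_Collect_finite_All)
    qed
    then show ?thesis by (auto simp: \<C>_def)
  qed
  have stable: "Int_stable \<C>"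
  proof (rule Int_stableI)
    fix a b assume "a \<in> \<C>" "b \<in> \<C>"
    then obtain S B S' B' where ab: "a = cyl S B" "b = cyl S' B'" "finite S" "finite S'"
      "S \<subseteq> {0..t}" "S' \<subseteq> {0..t}" by (auto simp: \<C>_def)
    have "a \<inter> b = cyl (S \<union> S') (\<lambda>s. (if s \<in> S then B s else UNIV) \<inter> (if s \<in> S' then B' s else UNIV))"
      by (auto simp: ab cyl_def)
    then show "a \<inter> b \<in> \<C>" using ab unfolding \<C>_def by blast
  qed
  have "indep_set \<C> {no_arrival t \<epsilon>}"
  proof (rule indep_setI[OF ev])
    show "{no_arrival t \<epsilon>} \<subseteq> events" using assms by simp
    show "prob (a \<inter> b) = prob a * prob b" if "a \<in> \<C>" "b \<in> {no_arrival t \<epsilon>}" for a b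
      using that finite_past_independent[OF _ _ \<open>0 \<le> t\<close> \<open>0 \<le> \<epsilon>\<close>] by (auto simp: \<C>_def cyl_def)
  qed
  then have "indep_set (sigma_sets (space M) \<C>) (sigma_sets (space M) {no_arrival t \<epsilon>})"
    by (rule indep_set_sigma_sets[OF _ stable]) (simp add: Int_stable_def)
  moreover have "A \<in> sigma_sets (space M) \<C>"
  proof -
    have "{N s -` B \<inter> space M | s B. s \<in> {0..t} \<and> B \<in> sets (count_space UNIV)} \<subseteq> \<C>"
    proof safe
      fix s :: real and B :: "nat set" assume "s \<in> {0..t}"
      then have "N s -` B \<inter> space M = cyl {s} (\<lambda>_. B)" "finite {s}" "{s} \<subseteq> {0..t}"
        by (auto simp: cyl_def)
      then show "N s -` B \<inter> space M \<in> \<C>" unfolding \<C>_def by blast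
    qed
    then show ?thesis
      using A unfolding sets_history generated_events_def by (rule sigma_sets_mono'[THEN subsetD])
  qed
  ultimately show ?thesis
    using prob_no_arrival[OF assms(2,3)] indep_setD[of "sigma_sets (space M) \<C>" _ A "no_arrival t \<epsilon>"]
    by simp
qed

lemma AE_unbounded: "AE \<omega> in M. \<forall>m. \<exists>t\<ge>0. m \<le> N t \<omega>"
proof (subst AE_all_countable, rule allI)
  fix m :: nat
  have lim: "(\<lambda>k. \<Sum>j<m. (rate * real (Suc k)) ^ j / fact j * exp (- (rate * real (Suc k)))) \<longlonglongrightarrow> (\<Sum>j<m. 0)"
  proof (rule tendsto_sum)
    fix j
    define a where "a k = rate * real (Suc k)" for k
    have "filterlim a at_top sequentially"
      unfolding a_def using rate by real_asymp
    then have "(\<lambda>k. a k ^ j / exp (a k)) \<longlonglongrightarrow> 0"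
      by (rule filterlim_compose[OF tendsto_power_div_exp_0])
    then have "(\<lambda>k. 1 / fact j * (a k ^ j / exp (a k))) \<longlonglongrightarrow> 0"
      by (rule tendsto_mult_right_zero)
    then have "(\<lambda>k. a k ^ j / fact j * exp (- a k)) \<longlonglongrightarrow> 0"
      by (simp add: exp_minus divide_inverse mult.commute mult.left_commute)
    then show "(\<lambda>k. (rate * real (Suc k)) ^ j / fact j * exp (- (rate * real (Suc k)))) \<longlonglongrightarrow> 0"
      by (simp only: a_def)
  qed
  define D where "D k = {\<omega>\<in>space M. N (real (Suc k)) \<omega> - N 0 \<omega> \<in> {..<m}}" for k
  have D_prob: "prob (D k) = (\<Sum>j<m. (rate * real (Suc k)) ^ j / fact j * exp (- (rate * real (Suc k))))" for k
    unfolding D_def using increment_law[of 0 "real (Suc k)" "{..<m}"] rate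
    by (simp add: measure_measure_pmf_finite)
  have D_sets: "D k \<in> events" for k
  proof -
    have [measurable]: "N (real (Suc k)) \<in> M \<rightarrow>\<^sub>M count_space UNIV" "N 0 \<in> M \<rightarrow>\<^sub>M count_space UNIV" by auto
    show ?thesis unfolding D_def by measurable
  qed
  have "prob (\<Inter>k. D k) \<le> 0"
  proof (rule LIMSEQ_le_const[OF lim[unfolded sum.neutral_const], folded D_prob])
    show "\<exists>K. \<forall>k\<ge>K. prob (\<Inter>k. D k) \<le> prob (D k)"
      using D_sets by (intro exI[of _ 0] allI impI finite_measure_mono) auto
  qed
  then have "prob (\<Inter>k. D k) = 0" by (simp add: measure_le_0_iff)
  then have "(\<Inter>k. D k) \<in> null_sets M"
    using D_sets by (auto simp: null_sets_def emeasure_eq_measure)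
  then show "AE \<omega> in M. \<exists>t\<ge>0. m \<le> N t \<omega>"
  proof (rule AE_I')
    show "{\<omega>\<in>space M. \<not> (\<exists>t\<ge>0. m \<le> N t \<omega>)} \<subseteq> (\<Inter>k. D k)"
    proof safe
      fix \<omega> k assume "\<omega> \<in> space M" "\<not> (\<exists>t\<ge>0. m \<le> N t \<omega>)"
      then have "\<not> m \<le> N (real (Suc k)) \<omega>" by (meson of_nat_0_le_iff)
      then show "\<omega> \<in> D k" using \<open>\<omega> \<in> space M\<close> by (auto simp: D_def not_le N_0)
    qed
  qed
qed

text \<open>
  This is quadratic in the length of the interval, while the number of intervals needed to cover a bounded
  time range is only inversely proportional to it.
\<close>

lemma prob_double_jump:
  assumes "0 \<le> s" "0 < h"
  shows "prob {\<omega>\<in>space M. N (s + h) \<omega> - N s \<omega> \<in> - {0, 1}} \<le> (rate * h)\<^sup>2"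
proof -
  define a where "a = rate * h"
  have a: "0 < a" using rate assms by (simp add: a_def)
  have "prob {\<omega>\<in>space M. N (s + h) \<omega> - N s \<omega> \<in> - {0, 1}} = measure (measure_pmf (poisson_pmf a)) (- {0, 1})"
    using increment_law[of s "s + h" "- {0, 1}"] assms by (simp add: a_def)
  also have "\<dots> = 1 - measure (measure_pmf (poisson_pmf a)) {0, 1}"
    using measure_pmf.prob_compl[of "{0, 1}" "poisson_pmf a"] by (simp add: Compl_eq_Diff_UNIV)
  also have "measure (measure_pmf (poisson_pmf a)) {0, 1} = exp (- a) * (1 + a)"
    using a by (simp add: measure_measure_pmf_finite algebra_simps)
  also have "1 - exp (- a) * (1 + a) \<le> 1 - (1 - a) * (1 + a)"
    using exp_ge_add_one_self[of "- a"] a by (intro diff_left_mono mult_right_mono) auto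
  also have "\<dots> = a\<^sup>2" by (simp add: algebra_simps power2_eq_square)
  finally show ?thesis by (simp add: a_def)
qed

text \<open>
  If the level \<open>m\<close> is skipped before time \<open>K\<close>, then in every partition of \<open>[0, K]\<close> some interval has an
  increment of at least \<open>2\<close>. For partitions into intervals of length \<open>h\<close> this has probability at most
  \<open>K rate\<^sup>2 h\<close>.
\<close>

lemma AE_no_level_skipped: "AE \<omega> in M. m \<le> N (real K) \<omega> \<longrightarrow> (\<exists>t\<ge>0. N t \<omega> = m)"
proof -
  define h where "h n = 1 / real (Suc n)" for n
  have h: "0 < h n" for n by (simp add: h_def)
  define J where "J n k = {\<omega>\<in>space M. N (real k * h n + h n) \<omega> - N (real k * h n) \<omega> \<in> - {0, 1}}" for n k
  define E where "E n = (\<Union>k<K * Suc n. J n k)" for n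
  have J_sets: "J n k \<in> events" for n k
  proof -
    have [measurable]: "N (real k * h n + h n) \<in> M \<rightarrow>\<^sub>M count_space UNIV"
      "N (real k * h n) \<in> M \<rightarrow>\<^sub>M count_space UNIV" using h[of n] by auto
    show ?thesis unfolding J_def by measurable
  qed
  then have E_sets: "E n \<in> events" for n by (auto simp: E_def)
  have E_prob: "prob (E n) \<le> real K * rate\<^sup>2 * h n" for n
  proof -
    have "prob (E n) \<le> (\<Sum>k<K * Suc n. prob (J n k))"
      unfolding E_def using J_sets by (intro finite_measure_subadditive_finite) auto
    also have "\<dots> \<le> (\<Sum>k<K * Suc n. (rate * h n)\<^sup>2)"
      unfolding J_def using h[of n] by (intro sum_mono prob_double_jump) auto
    also have "\<dots> = real K * rate\<^sup>2 * h n"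
    proof -
      have "real (Suc n) * h n = 1" by (simp add: h_def del: of_nat_Suc)
      moreover have "(\<Sum>k<K * Suc n. (rate * h n)\<^sup>2) = real K * rate\<^sup>2 * h n * (real (Suc n) * h n)"
        by (simp add: power2_eq_square del: of_nat_Suc mult_Suc_right)
      ultimately show ?thesis by simp
    qed
    finally show ?thesis .
  qed
  have "prob (\<Inter>n. E n) \<le> 0"
  proof (rule LIMSEQ_le_const)
    show "(\<lambda>n. real K * rate\<^sup>2 * h n) \<longlonglongrightarrow> 0"
      unfolding h_def by (intro tendsto_mult_right_zero LIMSEQ_Suc[OF lim_1_over_n])
    show "\<exists>n0. \<forall>n\<ge>n0. prob (\<Inter>n. E n) \<le> real K * rate\<^sup>2 * h n"
      using E_sets by (intro exI[of _ 0] allI impI order.trans[OF finite_measure_mono E_prob]) auto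
  qed
  then have "prob (\<Inter>n. E n) = 0" by (simp add: measure_le_0_iff)
  then have "(\<Inter>n. E n) \<in> null_sets M"
    using E_sets by (auto simp: null_sets_def emeasure_eq_measure)
  then show ?thesis
  proof (rule AE_I')
    show "{\<omega>\<in>space M. \<not> (m \<le> N (real K) \<omega> \<longrightarrow> (\<exists>t\<ge>0. N t \<omega> = m))} \<subseteq> (\<Inter>n. E n)"
    proof (intro subsetI INT_I)
      fix \<omega> n assume "\<omega> \<in> {\<omega>\<in>space M. \<not> (m \<le> N (real K) \<omega> \<longrightarrow> (\<exists>t\<ge>0. N t \<omega> = m))}"
      then have \<omega>: "\<omega> \<in> space M" and m: "m \<le> N (real K) \<omega>" and skip: "\<not> (\<exists>t\<ge>0. N t \<omega> = m)"
        by blast+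
      \<comment> \<open>The partition interval ending at \<open>j * h n\<close> contains the jump over \<open>m\<close>.\<close>
      define j where "j = (LEAST j. m \<le> N (real j * h n) \<omega>)"
      have last: "real (K * Suc n) * h n = real K" by (simp add: h_def del: of_nat_Suc mult_Suc_right)
      have ex: "m \<le> N (real (K * Suc n) * h n) \<omega>" unfolding last by (rule m)
      have j: "m \<le> N (real j * h n) \<omega>" "j \<le> K * Suc n"
        unfolding j_def using ex by (rule LeastI, rule Least_le)
      have ne: "N (real i * h n) \<omega> \<noteq> m" for i using skip h[of n] by auto
      have "j \<noteq> 0" using j(1) ne[of 0] N_0[OF \<omega>] by (cases "j = 0") auto
      then obtain i where i: "j = Suc i" by (cases j) auto
      have "\<not> m \<le> N (real i * h n) \<omega>" using not_less_Least[of i "\<lambda>j. m \<le> N (real j * h n) \<omega>"] i by (simp add: j_def)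
      moreover have "m < N (real i * h n + h n) \<omega>"
        using j(1) ne[of j] by (simp add: i distrib_right add.commute)
      ultimately have "\<omega> \<in> J n i" using \<omega> by (auto simp: J_def)
      then show "\<omega> \<in> E n" using j(2) i by (auto simp: E_def)
    qed
  qed
qed

lemma AE_all_levels: "AE \<omega> in M. \<forall>m. \<exists>t\<ge>0. N t \<omega> = m"
proof -
  have "AE \<omega> in M. \<forall>m K. m \<le> N (real K) \<omega> \<longrightarrow> (\<exists>t\<ge>0. N t \<omega> = m)"
    by (simp only: AE_all_countable) (intro allI AE_no_level_skipped)
  then show ?thesis using AE_unbounded AE_space
  proof eventually_elim
    case (elim \<omega>)
    show ?case
    proof
      fix m
      obtain t where t: "0 \<le> t" "m \<le> N t \<omega>" using elim(2) by blast
      obtain K where "t \<le> real K" using real_arch_simple by blast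
      then have "m \<le> N (real K) \<omega>" using N_mono[OF elim(3) t(1)] t(2) le_trans by blast
      then show "\<exists>t\<ge>0. N t \<omega> = m" using elim(1) by blast
    qed
  qed
qed

definition T :: "nat \<Rightarrow> 'a \<Rightarrow> real" where
  "T m \<omega> = arrival (\<lambda>t. N t \<omega>) m"

abbreviation all_past :: "'a measure" where
  "all_past \<equiv> history M {0..} N (count_space UNIV)"

lemma N_all_past: "0 \<le> t \<Longrightarrow> N t \<in> all_past \<rightarrow>\<^sub>M count_space UNIV"
  by (rule history_measurable) auto

lemma all_past_subset: "sets all_past \<subseteq> sets M"
  by (rule history_subset) auto

lemma T_le_iff:
  assumes "\<omega> \<in> space M" "0 \<le> s"
  shows "T i \<omega> \<le> s \<longleftrightarrow> i \<le> N s \<omega> \<or> (\<forall>k::nat. \<not> i \<le> N (real k) \<omega>)"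
proof (cases "\<exists>t\<ge>0. i \<le> N t \<omega>")
  case True
  then obtain t where t: "0 \<le> t" "i \<le> N t \<omega>" by blast
  obtain k where "t \<le> real k" using real_arch_simple by blast
  then have "i \<le> N (real k) \<omega>" using N_mono[OF assms(1) t(1)] t(2) le_trans by blast
  then show ?thesis using arrival_le_iff[OF path[OF assms(1)] True assms(2)] by (auto simp: T_def)
next
  case False
  then show ?thesis using assms by (auto simp: T_def arrival_def)
qed

lemma T_all_past: "T i \<in> borel_measurable all_past"
proof (rule borel_measurableI_le)
  fix s
  show "{\<omega>\<in>space all_past. T i \<omega> \<le> s} \<in> sets all_past"
  proof (cases "0 \<le> s")
    case True
    note N_all_past[measurable]
    have "{\<omega>\<in>space all_past. i \<le> N s \<omega> \<or> (\<forall>k::nat. \<not> i \<le> N (real k) \<omega>)} \<in> sets all_past"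
    proof -
      have [measurable]: "N s \<in> all_past \<rightarrow>\<^sub>M count_space UNIV" using True by (rule N_all_past)
      have [measurable]: "N (real k) \<in> all_past \<rightarrow>\<^sub>M count_space UNIV" for k by (rule N_all_past) simp
      show ?thesis by measurable
    qed
    also have "{\<omega>\<in>space all_past. i \<le> N s \<omega> \<or> (\<forall>k::nat. \<not> i \<le> N (real k) \<omega>)} =
        {\<omega>\<in>space all_past. T i \<omega> \<le> s}"
      using T_le_iff[OF _ True] by auto
    finally show ?thesis .
  next
    case False
    then have "{\<omega>\<in>space all_past. T i \<omega> \<le> s} = {}"
      using arrival_nonneg by (auto simp: T_def dest: order.trans)
    then show ?thesis by (simp only: sets.empty_sets)
  qed
qed

lemma T_measurable [measurable]: "T i \<in> borel_measurable M"
  using T_all_past all_past_subset by (auto simp: measurable_def)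

lemma T_nonneg: "0 \<le> T i \<omega>"
  by (simp add: T_def arrival_nonneg)

abbreviation arrivals :: "nat \<Rightarrow> 'a measure" where
  "arrivals m \<equiv> history M {..m} T borel"

lemma level_event: "0 \<le> s \<Longrightarrow> s \<le> t \<Longrightarrow> {\<omega>\<in>space M. i \<le> N s \<omega>} \<in> sets (past t)"
proof -
  assume "0 \<le> s" "s \<le> t"
  then have "N s -` {i..} \<inter> space (past t) \<in> sets (past t)"
    by (intro measurable_sets[OF N_past]) auto
  also have "N s -` {i..} \<inter> space (past t) = {\<omega>\<in>space M. i \<le> N s \<omega>}" by auto
  finally show ?thesis .
qed

text \<open>
  Once level \<open>m\<close> is reached, all arrival times up to index \<open>m\<close> can be read off the path up to the present:
  an event determined by them belongs to the stopped \<open>\<sigma>\<close>-algebra of \<open>T m\<close>.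
\<close>

lemma arrivals_adapted:
  assumes A: "A \<in> sets (arrivals m)" and "0 \<le> t"
  shows "A \<inter> {\<omega>\<in>space M. m \<le> N t \<omega>} \<in> sets (past t)"
proof -
  define R where "R = {\<omega>\<in>space M. m \<le> N t \<omega>}"
  have R: "R \<in> sets (past t)" unfolding R_def by (rule level_event[OF \<open>0 \<le> t\<close>]) simp
  \<comment> \<open>It suffices that the generating events lie in the \<open>\<sigma>\<close>-algebra of events whose trace on \<open>R\<close> is known at
    time \<open>t\<close>.\<close>
  define \<D> where "\<D> = {A. A \<subseteq> space M \<and> A \<inter> R \<in> sets (past t)}"
  have \<D>: "sigma_algebra (space M) \<D>"
    unfolding sigma_algebra_iff2
  proof (intro conjI ballI allI impI)
    show "{} \<in> \<D>" by (simp add: \<D>_def)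
    show "\<D> \<subseteq> Pow (space M)" by (auto simp: \<D>_def)
    show "space M - a \<in> \<D>" if "a \<in> \<D>" for a
    proof -
      have "(space M - a) \<inter> R = R - a \<inter> R" by (auto simp: R_def)
      then show ?thesis using that R by (auto simp: \<D>_def)
    qed
    show "(\<Union>i::nat. a i) \<in> \<D>" if "range a \<subseteq> \<D>" for a
    proof -
      have "(\<Union>i. a i) \<inter> R = (\<Union>i. a i \<inter> R)" by auto
      moreover have "(\<Union>i. a i \<inter> R) \<in> sets (past t)"
        using that by (intro sets.countable_UN) (auto simp: \<D>_def)
      ultimately show ?thesis using that by (auto simp: \<D>_def)
    qed
  qed
  interpret \<D>: sigma_algebra "space M" \<D> by (rule \<D>)
  define \<D>' where "\<D>' = sigma (space M) \<D>"
  have \<D>': "sets \<D>' = \<D>" "space \<D>' = space M"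
    unfolding \<D>'_def using \<D>.space_closed by (auto simp: sets_measure_of \<D>.sigma_sets_eq)
  have T: "T i \<in> borel_measurable \<D>'" if "i \<le> m" for i
  proof (rule borel_measurableI_le)
    fix s
    have "{\<omega>\<in>space M. T i \<omega> \<le> s} \<inter> R \<in> sets (past t)"
    proof (cases "0 \<le> s")
      case True
      have "{\<omega>\<in>space M. T i \<omega> \<le> s} \<inter> R = {\<omega>\<in>space M. i \<le> N (min s t) \<omega>} \<inter> R"
      proof -
        have "T i \<omega> \<le> s \<longleftrightarrow> i \<le> N (min s t) \<omega>" if "\<omega> \<in> R" for \<omega>
        proof -
          have \<omega>: "\<omega> \<in> space M" "i \<le> N t \<omega>" using that \<open>i \<le> m\<close> by (auto simp: R_def)
          then have ex: "\<exists>u\<ge>0. i \<le> N u \<omega>" using \<open>0 \<le> t\<close> by auto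
          note iff = arrival_le_iff[OF path[OF \<omega>(1)] ex, folded T_def]
          show ?thesis using iff[of s] iff[of t] \<omega> True \<open>0 \<le> t\<close> by (auto simp: min_def)
        qed
        then show ?thesis by (auto simp: R_def)
      qed
      moreover have "{\<omega>\<in>space M. i \<le> N (min s t) \<omega>} \<in> sets (past t)"
        using True \<open>0 \<le> t\<close> by (intro level_event) auto
      ultimately show ?thesis using R by auto
    next
      case False
      then have "{\<omega>\<in>space M. T i \<omega> \<le> s} = {}" using T_nonneg by (auto dest: order.trans)
      then show ?thesis by (simp only: Int_empty_left sets.empty_sets)
    qed
    then show "{\<omega>\<in>space \<D>'. T i \<omega> \<le> s} \<in> sets \<D>'" unfolding \<D>' by (auto simp: \<D>_def)
  qed
  have "sets (arrivals m) \<subseteq> sets \<D>'"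
    unfolding sets_history generated_events_def \<D>'(2)[symmetric]
    by (rule sets.sigma_sets_subset) (use T in \<open>auto intro: measurable_sets\<close>)
  then show ?thesis using A by (auto simp: \<D>' \<D>_def R_def)
qed

lemma arrivals_subset: "sets (arrivals m) \<subseteq> sets M"
  by (rule history_subset) auto

lemma arrivals_all_past: "sets (arrivals m) \<subseteq> sets all_past"
proof -
  have "T i -` A \<inter> space M \<in> sets all_past" if "A \<in> sets borel" for i A
    using measurable_sets[OF T_all_past that, of i] by simp
  then have "{T i -` A \<inter> space M | i A. i \<in> {..m} \<and> A \<in> sets borel} \<subseteq> sets all_past" by auto
  from sets.sigma_sets_subset[OF this] show ?thesis
    unfolding sets_history[of M "{..m}"] generated_events_def by simp
qed


definition holding :: "nat \<Rightarrow> 'a \<Rightarrow> real" where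
  "holding m \<omega> = T (Suc m) \<omega> - T m \<omega>"

lemma holding_measurable [measurable]: "holding m \<in> borel_measurable M"
  unfolding holding_def by measurable

text \<open>
  The first grid time at which level \<open>m\<close> is reached tends to \<open>T m\<close> from the right as the grid is refined, so
  by right-continuity the grid time may be replaced by \<open>T m\<close> in the end.
\<close>

lemma grid_limit:
  fixes m :: nat and \<epsilon> :: real
  assumes \<omega>: "\<omega> \<in> space M" and levels: "\<forall>m. \<exists>t\<ge>0. N t \<omega> = m" and "0 \<le> \<epsilon>"
  defines "k \<equiv> \<lambda>n. LEAST k. m \<le> N (real k * (1 / real (Suc n))) \<omega>"
  shows "eventually (\<lambda>n. N (real (k n) * (1 / real (Suc n)) + \<epsilon>) \<omega> = N (real (k n) * (1 / real (Suc n))) \<omega>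
    \<longleftrightarrow> \<epsilon> < holding m \<omega>) sequentially"
proof -
  note path = path[OF \<omega>]
  have reach: "\<exists>t\<ge>0. j \<le> N t \<omega>" for j using levels by (metis order_refl)
  note T_iff = arrival_le_iff[OF path reach, folded T_def]
  obtain t where t: "0 \<le> t" "N t \<omega> = m" using levels by blast
  have NT: "N (T m \<omega>) \<omega> = m"
    using level_at_arrival(2)[OF path t(1)] t(2) by (simp add: T_def)
  have hold: "\<epsilon> < holding m \<omega> \<longleftrightarrow> N (T m \<omega> + \<epsilon>) \<omega> = m"
  proof -
    have "m \<le> N (T m \<omega> + \<epsilon>) \<omega>"
      using N_mono[OF \<omega> T_nonneg[of m \<omega>], of "T m \<omega> + \<epsilon>"] NT \<open>0 \<le> \<epsilon>\<close> by simp
    moreover have "T (Suc m) \<omega> \<le> T m \<omega> + \<epsilon> \<longleftrightarrow> Suc m \<le> N (T m \<omega> + \<epsilon>) \<omega>"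
      using T_iff T_nonneg[of m \<omega>] \<open>0 \<le> \<epsilon>\<close> by simp
    ultimately show ?thesis by (auto simp: holding_def)
  qed
  have const: "eventually (\<lambda>n. \<forall>s. c \<le> s \<and> s < c + 1 / real (Suc n) \<longrightarrow> N s \<omega> = N c \<omega>) sequentially"
    if "0 \<le> c" for c
  proof -
    obtain b where b: "c < b" "\<And>s. c < s \<Longrightarrow> s < b \<Longrightarrow> N s \<omega> = N c \<omega>"
      using counting_path_right_constant[OF path \<open>0 \<le> c\<close>] by (auto simp: eventually_at_right_field)
    have "(\<lambda>n. 1 / real (Suc n)) \<longlonglongrightarrow> 0" by (rule LIMSEQ_Suc[OF lim_1_over_n])
    then have "eventually (\<lambda>n. 1 / real (Suc n) < b - c) sequentially"
      using b(1) by (intro order_tendstoD) auto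
    then show ?thesis
    proof eventually_elim
      case (elim n)
      show ?case
      proof safe
        fix s assume s: "c \<le> s" "s < c + 1 / real (Suc n)"
        then show "N s \<omega> = N c \<omega>" using b(2)[of s] elim by (cases "s = c") auto
      qed
    qed
  qed
  have grid: "T m \<omega> \<le> real (k n) * (1 / real (Suc n))"
    "real (k n) * (1 / real (Suc n)) < T m \<omega> + 1 / real (Suc n)" for n
  proof -
    define h where "h = 1 / real (Suc n)"
    have h: "0 < h" by (simp add: h_def)
    obtain j where "T m \<omega> / h \<le> real j" using real_arch_simple by blast
    then have "T m \<omega> \<le> real j * h" using h by (simp add: field_simps)
    then have "m \<le> N (real j * h) \<omega>" using T_iff[of "real j * h" m] h by simp
    then have "m \<le> N (real (k n) * h) \<omega>" unfolding k_def h_def by (rule LeastI)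
    then show "T m \<omega> \<le> real (k n) * (1 / real (Suc n))"
      using T_iff[of "real (k n) * h" m] h by (simp add: h_def)
    have "real (k n) * h < T m \<omega> + h"
    proof (cases "k n")
      case 0
      then show ?thesis using T_nonneg[of m \<omega>] h by simp
    next
      case (Suc i)
      then have "\<not> m \<le> N (real i * h) \<omega>" unfolding k_def h_def by (metis lessI not_less_Least)
      then have "real i * h < T m \<omega>" using T_iff[of "real i * h" m] h by simp
      then show ?thesis by (simp add: Suc distrib_right)
    qed
    then show "real (k n) * (1 / real (Suc n)) < T m \<omega> + 1 / real (Suc n)" by (simp add: h_def)
  qed
  have "0 \<le> T m \<omega> + \<epsilon>" using T_nonneg[of m \<omega>] \<open>0 \<le> \<epsilon>\<close> by simp
  from const[OF T_nonneg[of m \<omega>]] const[OF this] show ?thesis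
  proof eventually_elim
    case (elim n)
    have "N (real (k n) * (1 / real (Suc n))) \<omega> = m"
      using elim(1) grid[of n] NT by auto
    moreover have "N (real (k n) * (1 / real (Suc n)) + \<epsilon>) \<omega> = N (T m \<omega> + \<epsilon>) \<omega>"
      using elim(2)[rule_format, of "real (k n) * (1 / real (Suc n)) + \<epsilon>"] grid[of n] by simp
    ultimately show ?case using hold by simp
  qed
qed

text \<open>
  The strong Markov property at \<open>T m\<close>. For the first grid time after \<open>T m\<close> it follows from the independence of
  the increments by summing over the values of this grid time; refining the grid gives the
  result for \<open>T m\<close> itself.
\<close>

lemma prob_holding:
  assumes A: "A \<in> sets (arrivals m)" and "0 \<le> \<epsilon>"
  shows "prob (A \<inter> {\<omega>\<in>space M. \<epsilon> < holding m \<omega>}) = prob A * exp (- rate * \<epsilon>)"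
proof -
  have AM [measurable]: "A \<in> events" using A arrivals_subset by auto
  define h where "h n = 1 / real (Suc n)" for n
  have h: "0 < h n" for n by (simp add: h_def)
  \<comment> \<open>The first grid time, with mesh \<open>h n\<close>, at which level \<open>m\<close> is reached is \<open>k * h n\<close>.\<close>
  define E where "E n k = {\<omega>\<in>space M. m \<le> N (real k * h n) \<omega> \<and> (\<forall>j<k. \<not> m \<le> N (real j * h n) \<omega>)}" for n k
  have E_past: "A \<inter> E n k \<in> sets (past (real k * h n))" for n k
  proof -
    let ?P = "past (real k * h n)"
    have "{\<omega>\<in>space M. m \<le> N (real j * h n) \<omega>} \<in> sets ?P" if "j \<in> {..<k}" for j
      using that h[of n] by (intro level_event) (auto intro!: mult_right_mono)
    then have "(A \<inter> {\<omega>\<in>space M. m \<le> N (real k * h n) \<omega>}) - (\<Union>j\<in>{..<k}. {\<omega>\<in>space M. m \<le> N (real j * h n) \<omega>}) \<in> sets ?P"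
      using h[of n] by (intro sets.Diff sets.finite_UN arrivals_adapted A) auto
    also have "(A \<inter> {\<omega>\<in>space M. m \<le> N (real k * h n) \<omega>}) - (\<Union>j\<in>{..<k}. {\<omega>\<in>space M. m \<le> N (real j * h n) \<omega>}) = A \<inter> E n k"
      by (auto simp: E_def)
    finally show ?thesis .
  qed
  then have AE_sets: "A \<inter> E n k \<in> events" for n k using past_subset by blast
  have disj: "disjoint_family (\<lambda>k. A \<inter> E n k)" for n
    unfolding disjoint_family_on_def
  proof safe
    fix i j :: nat and \<omega> assume "i \<noteq> j" "\<omega> \<in> E n i" "\<omega> \<in> E n j"
    then show "\<omega> \<in> {}" by (cases i j rule: linorder_cases) (auto simp: E_def)
  qed
  define D where "D n = (\<Union>k. A \<inter> E n k \<inter> no_arrival (real k * h n) \<epsilon>)" for n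
  have na: "no_arrival (real k * h n) \<epsilon> \<in> events" for n k
    using h[of n] \<open>0 \<le> \<epsilon>\<close> by (intro no_arrival_sets) auto
  have D_sets [measurable]: "D n \<in> events" for n
    unfolding D_def using AE_sets na by (intro sets.countable_UN) auto
  have E_iff: "\<omega> \<in> E n k \<longleftrightarrow> k = (LEAST k. m \<le> N (real k * h n) \<omega>)"
    if \<omega>: "\<omega> \<in> space M" "\<exists>t\<ge>0. N t \<omega> = m" for \<omega> n k
  proof -
    define P where "P k \<longleftrightarrow> m \<le> N (real k * h n) \<omega>" for k
    obtain t where t: "0 \<le> t" "N t \<omega> = m" using \<omega>(2) by blast
    obtain j where "t / h n \<le> real j" using real_arch_simple by blast
    then have "t \<le> real j * h n" using h[of n] by (simp add: field_simps)
    then have ex: "P j" using N_mono[OF \<omega>(1) t(1)] t(2) by (simp add: P_def)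
    have "\<omega> \<in> E n k \<longleftrightarrow> P k \<and> (\<forall>j<k. \<not> P j)" using \<omega>(1) by (simp add: E_def P_def)
    also have "\<dots> \<longleftrightarrow> k = (LEAST k. P k)"
      using LeastI[of P, OF ex] not_less_Least[of _ P] Least_le[of P] by (metis nat_neq_iff)
    finally show ?thesis by (simp add: P_def)
  qed
  have D_prob: "prob (D n) = prob A * exp (- rate * \<epsilon>)" for n
  proof -
    have "(\<lambda>k. prob (A \<inter> E n k \<inter> no_arrival (real k * h n) \<epsilon>)) sums prob (D n)"
      unfolding D_def
    proof (rule finite_measure_UNION)
      show "range (\<lambda>k. A \<inter> E n k \<inter> no_arrival (real k * h n) \<epsilon>) \<subseteq> events"
        using AE_sets na by auto
      show "disjoint_family (\<lambda>k. A \<inter> E n k \<inter> no_arrival (real k * h n) \<epsilon>)"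
        by (rule disjoint_family_on_bisimulation[OF disj[of n]]) auto
    qed
    moreover have "prob (A \<inter> E n k \<inter> no_arrival (real k * h n) \<epsilon>) = prob (A \<inter> E n k) * exp (- rate * \<epsilon>)" for k
      using h[of n] \<open>0 \<le> \<epsilon>\<close> by (intro past_independent E_past) auto
    moreover have "(\<lambda>k. prob (A \<inter> E n k) * exp (- rate * \<epsilon>)) sums (prob (\<Union>k. A \<inter> E n k) * exp (- rate * \<epsilon>))"
      using AE_sets by (intro sums_mult2 finite_measure_UNION disj) auto
    ultimately have "prob (D n) = prob (\<Union>k. A \<inter> E n k) * exp (- rate * \<epsilon>)"
      by (simp add: sums_unique2)
    also have "prob (\<Union>k. A \<inter> E n k) = prob A"
    proof (rule finite_measure_eq_AE)
      show "AE \<omega> in M. \<omega> \<in> (\<Union>k. A \<inter> E n k) \<longleftrightarrow> \<omega> \<in> A"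
        using AE_all_levels AE_space by eventually_elim (simp add: E_iff)
      show "(\<Union>k. A \<inter> E n k) \<in> events"
        using AE_sets by (intro sets.countable_UN) blast
    qed simp
    finally show ?thesis .
  qed
  have "(\<lambda>n. \<integral>\<omega>. indicator (D n) \<omega> \<partial>M) \<longlonglongrightarrow>
    (\<integral>\<omega>. indicator (A \<inter> {\<omega>\<in>space M. \<epsilon> < holding m \<omega>}) \<omega> \<partial>M :: real)"
  proof (rule integral_dominated_convergence[where w="\<lambda>_. 1"])
    show "AE \<omega> in M. (\<lambda>n. indicator (D n) \<omega> :: real) \<longlonglongrightarrow>
        indicator (A \<inter> {\<omega>\<in>space M. \<epsilon> < holding m \<omega>}) \<omega>"
      using AE_all_levels AE_space
    proof eventually_elim
      case (elim \<omega>)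
      from grid_limit[OF elim(2,1) \<open>0 \<le> \<epsilon>\<close>, of m]
      have "eventually (\<lambda>n. (indicator (D n) \<omega> :: real) = indicator (A \<inter> {\<omega>\<in>space M. \<epsilon> < holding m \<omega>}) \<omega>) sequentially"
      proof eventually_elim
        case (elim n)
        then have "\<omega> \<in> D n \<longleftrightarrow> \<omega> \<in> A \<inter> {\<omega>\<in>space M. \<epsilon> < holding m \<omega>}"
          using \<open>\<omega> \<in> space M\<close> \<open>\<forall>m. \<exists>t\<ge>0. N t \<omega> = m\<close>
          by (auto simp: D_def E_iff no_arrival_def h_def)
        then show ?case by (simp add: indicator_def)
      qed
      then show ?case by (rule tendsto_eventually)
    qed
  qed auto
  then have "(\<lambda>n. prob (D n)) \<longlonglongrightarrow> prob (A \<inter> {\<omega>\<in>space M. \<epsilon> < holding m \<omega>})" by simp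
  then show ?thesis by (simp add: D_prob LIMSEQ_const_iff)
qed

lemma holding_exponential: "distributed M lborel (holding m) (exponential_density rate)"
proof -
  have "\<P>(\<omega> in M. holding m \<omega> \<le> a) = 1 - exp (- a * rate)" if "0 \<le> a" for a
  proof -
    have "prob {\<omega>\<in>space M. holding m \<omega> \<le> a} = prob (space M - {\<omega>\<in>space M. a < holding m \<omega>})"
      by (rule arg_cong[where f=prob]) auto
    also have "\<dots> = 1 - prob {\<omega>\<in>space M. a < holding m \<omega>}" by (rule prob_compl) simp
    also have "prob {\<omega>\<in>space M. a < holding m \<omega>} = exp (- a * rate)"
    proof -
      have "space M \<in> sets (arrivals m)" using sets.top[of "arrivals m"] by simp
      from prob_holding[OF this \<open>0 \<le> a\<close>] show ?thesis
        by (simp add: prob_space mult.commute Int_absorb1)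
    qed
    finally show ?thesis .
  qed
  then show ?thesis using exponential_distributed_iff[OF rate] by simp
qed


lemma AE_holding_pos: "AE \<omega> in M. 0 < holding m \<omega>"
proof -
  have "space M \<in> sets (arrivals m)" using sets.top[of "arrivals m"] by simp
  from prob_holding[OF this order_refl] have "prob {\<omega>\<in>space M. 0 < holding m \<omega>} = 1"
    by (simp add: prob_space Int_absorb1)
  then show ?thesis by (subst (asm) prob_Collect_eq_1) auto
qed

lemma holding_independent:
  assumes A: "A \<in> sets (arrivals m)"
  shows "prob (A \<inter> {\<omega>\<in>space M. \<epsilon> < holding m \<omega>}) = prob A * prob {\<omega>\<in>space M. \<epsilon> < holding m \<omega>}"
proof (cases "0 \<le> \<epsilon>")
  case True
  have "space M \<in> sets (arrivals m)" using sets.top[of "arrivals m"] by simp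
  from prob_holding[OF this True] have "prob {\<omega>\<in>space M. \<epsilon> < holding m \<omega>} = exp (- rate * \<epsilon>)"
    by (simp add: prob_space Int_absorb1)
  then show ?thesis using prob_holding[OF A True] by simp
next
  case False
  have [measurable]: "A \<in> events" using A arrivals_subset by auto
  have all: "AE \<omega> in M. \<epsilon> < holding m \<omega>"
    using AE_holding_pos[of m] by eventually_elim (use False in auto)
  have "prob (A \<inter> {\<omega>\<in>space M. \<epsilon> < holding m \<omega>}) = prob A"
    by (rule finite_measure_eq_AE) (use all AE_space in \<open>auto elim!: eventually_mono eventually_elim2\<close>)
  moreover have "prob {\<omega>\<in>space M. \<epsilon> < holding m \<omega>} = 1"
    using all by (subst prob_Collect_eq_1) auto
  ultimately show ?thesis by simp
qed

text \<open>
  By right-continuity a level that is attained is attained at a rational time.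
\<close>

lemma level_attained_sets [measurable]: "{\<omega>\<in>space M. \<exists>t\<ge>0. N t \<omega> = m} \<in> events"
proof -
  have "(\<exists>t\<ge>0. N t \<omega> = m) \<longleftrightarrow> (\<exists>q\<in>{q::rat. 0 \<le> q}. N (of_rat q) \<omega> = m)" if \<omega>: "\<omega> \<in> space M" for \<omega>
  proof
    assume "\<exists>t\<ge>0. N t \<omega> = m"
    then obtain t where t: "0 \<le> t" "N t \<omega> = m" by blast
    obtain b where b: "t < b" "\<And>s. t < s \<Longrightarrow> s < b \<Longrightarrow> N s \<omega> = N t \<omega>"
      using counting_path_right_constant[OF path[OF \<omega>] t(1)] by (auto simp: eventually_at_right_field)
    obtain q where q: "t < of_rat q" "of_rat q < b" using of_rat_dense[OF b(1)] by blast
    then have "0 < (of_rat q :: real)" using t(1) by linarith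
    then have "0 \<le> q" by (simp add: zero_less_of_rat_iff)
    then show "\<exists>q\<in>{q::rat. 0 \<le> q}. N (of_rat q) \<omega> = m"
      using b(2)[OF q] t(2) by auto
  next
    assume "\<exists>q\<in>{q::rat. 0 \<le> q}. N (of_rat q) \<omega> = m"
    then obtain q :: rat where "0 \<le> q" "N (of_rat q) \<omega> = m" by blast
    then show "\<exists>t\<ge>0. N t \<omega> = m" by (intro exI[of _ "of_rat q"]) (simp add: zero_le_of_rat_iff)
  qed
  then have "{\<omega>\<in>space M. \<exists>t\<ge>0. N t \<omega> = m} = (\<Union>q\<in>{q::rat. 0 \<le> q}. N (of_rat q) -` {m} \<inter> space M)"
    by blast
  also have "\<dots> \<in> events"
    by (intro sets.countable_UN'' measurable_sets[OF N_measurable]) (auto simp: zero_le_of_rat_iff)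
  finally show ?thesis .
qed

end

section \<open>The embedded chain of the marked Poisson process\<close>

text \<open>
  The intersections of a member of \<open>A\<close> with a member of \<open>B\<close> form an intersection-stable generator of the
  join of the two \<open>\<sigma>\<close>-algebras, so it suffices to test these.
\<close>

lemma (in prob_space) indep_set_join:
  assumes ev: "A \<subseteq> events" "B \<subseteq> events" "C \<subseteq> events"
    and stable: "Int_stable A" "Int_stable B" "Int_stable C"
    and top: "space M \<in> A" "space M \<in> B"
    and ind: "\<And>a b c. a \<in> A \<Longrightarrow> b \<in> B \<Longrightarrow> c \<in> C \<Longrightarrow> prob (a \<inter> b \<inter> c) = prob (a \<inter> b) * prob c"
  shows "indep_set (sigma_sets (space M) (A \<union> B)) (sigma_sets (space M) C)"
proof -
  define D where "D = {a \<inter> b | a b. a \<in> A \<and> b \<in> B}"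
  have "indep_set D C"
    by (rule indep_setI) (use ev ind in \<open>auto simp: D_def\<close>)
  moreover have "Int_stable D"
  proof (rule Int_stableI)
    fix d e assume "d \<in> D" "e \<in> D"
    then obtain a b a' b' where de: "d = a \<inter> b" "e = a' \<inter> b'" "a \<in> A" "a' \<in> A" "b \<in> B" "b' \<in> B"
      by (auto simp: D_def)
    then have "a \<inter> a' \<in> A" "b \<inter> b' \<in> B" using stable by (auto simp: Int_stable_def)
    moreover have "d \<inter> e = (a \<inter> a') \<inter> (b \<inter> b')" using de by auto
    ultimately show "d \<inter> e \<in> D" unfolding D_def by blast
  qed
  ultimately have "indep_set (sigma_sets (space M) D) (sigma_sets (space M) C)"
    using stable by (intro indep_set_sigma_sets)
  moreover have "sigma_sets (space M) (A \<union> B) \<subseteq> sigma_sets (space M) D"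
  proof (rule sigma_sets_mono', rule subsetI)
    fix e assume "e \<in> A \<union> B"
    then have "e \<subseteq> space M" using ev sets.sets_into_space by blast
    then have "e = e \<inter> space M" "e = space M \<inter> e" by auto
    then show "e \<in> D" using top \<open>e \<in> A \<union> B\<close> unfolding D_def by blast
  qed
  ultimately show ?thesis
    unfolding indep_sets2_eq by blast
qed

lemma Int_stable_sets: "Int_stable (sets F)"
  by (auto simp: Int_stable_def)

lemma (in prob_space) indep_vars_next:
  fixes V :: "nat \<Rightarrow> 'a \<Rightarrow> 'b"
  assumes ind: "indep_vars (\<lambda>_. S) V {1..}"
    and b: "b \<in> sets (history M {1..n} V S)" and c: "C \<in> sets S"
  shows "prob (b \<inter> (V (Suc n) -` C \<inter> space M)) = prob b * prob (V (Suc n) -` C \<inter> space M)"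
proof -
  define E where "E i = {V i -` A \<inter> space M | A. A \<in> sets S}" for i
  define I where "I = case_bool {1..n} {Suc n}"
  have "indep_sets E {1..}" using ind unfolding indep_vars_def2 E_def by simp
  then have "indep_sets E (\<Union>j. I j)"
    by (rule indep_sets_mono_index[rotated]) (auto simp: I_def split: bool.splits)
  moreover have "Int_stable (E i)" for i
  proof (rule Int_stableI)
    fix x y assume "x \<in> E i" "y \<in> E i"
    then obtain A B where "x = V i -` A \<inter> space M" "y = V i -` B \<inter> space M" "A \<in> sets S" "B \<in> sets S"
      by (auto simp: E_def)
    then have "x \<inter> y = V i -` (A \<inter> B) \<inter> space M" "A \<inter> B \<in> sets S" by auto
    then show "x \<inter> y \<in> E i" unfolding E_def by blast
  qed
  moreover have "disjoint_family_on I UNIV"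
    by (auto simp: disjoint_family_on_def I_def split: bool.splits)
  ultimately have "indep_sets (\<lambda>j. sigma_sets (space M) (\<Union>i\<in>I j. E i)) UNIV"
    by (rule indep_sets_collect_sigma)
  then have "prob (\<Inter>j\<in>UNIV. case_bool b (V (Suc n) -` C \<inter> space M) j) =
     (\<Prod>j\<in>UNIV. prob (case_bool b (V (Suc n) -` C \<inter> space M) j))"
  proof (rule indep_setsD)
    show "\<forall>j\<in>UNIV. case_bool b (V (Suc n) -` C \<inter> space M) j \<in> sigma_sets (space M) (\<Union>i\<in>I j. E i)"
    proof
      fix j
      have "(\<Union>i\<in>{1..n}. E i) = {V i -` A \<inter> space M | i A. i \<in> {1..n} \<and> A \<in> sets S}"
        unfolding E_def by blast
      moreover have "V (Suc n) -` C \<inter> space M \<in> sigma_sets (space M) (E (Suc n))"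
        using c by (intro sigma_sets.Basic) (auto simp: E_def)
      ultimately show "case_bool b (V (Suc n) -` C \<inter> space M) j \<in> sigma_sets (space M) (\<Union>i\<in>I j. E i)"
        using b unfolding sets_history generated_events_def by (cases j) (auto simp: I_def)
    qed
  qed auto
  then show ?thesis by (simp add: UNIV_bool ac_simps)
qed

text \<open>
  The marks are indexed from \<open>1\<close>: mark \<open>n\<close> is the jump at the \<open>n\<close>-th arrival.
\<close>

locale marked_poisson = poisson_paths M N rate for M :: "'a measure" and N rate +
  fixes V :: "nat \<Rightarrow> 'a \<Rightarrow> real" and G :: "real measure"
  assumes V_distr: "\<And>n. distr M lborel (V (Suc n)) = G"
    and V_meas: "\<And>n. 1 \<le> n \<Longrightarrow> V n \<in> borel_measurable M"
    and V_indep: "indep_vars (\<lambda>_. borel) V {1..}"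
    and N_V_indep: "indep_set (generated_events M {0..} N (count_space UNIV)) (generated_events M {1..} V borel)"
begin

text \<open>
  Right after the \<open>n\<close>-th jump the past is \<open>joint_past n n\<close>, and right before the next jump it is
  \<open>joint_past (Suc n) n\<close>.
\<close>

definition joint_past :: "nat \<Rightarrow> nat \<Rightarrow> 'a measure" where
  "joint_past m n = sigma (space M) (sets (arrivals m) \<union> sets (history M {1..n} V borel))"

lemma marks_subset: "sets (history M {1..n} V borel) \<subseteq> events"
  by (rule history_subset) (auto intro: V_meas)

lemma joint_past_gen_closed: "sets (arrivals m) \<union> sets (history M {1..n} V borel) \<subseteq> Pow (space M)"
  using sets.space_closed[of "arrivals m"] sets.space_closed[of "history M {1..n} V borel"] by simp

lemma sets_joint_past:
  "sets (joint_past m n) = sigma_sets (space M) (sets (arrivals m) \<union> sets (history M {1..n} V borel))"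
  unfolding joint_past_def using joint_past_gen_closed by (rule sets_measure_of)

lemma space_joint_past: "space (joint_past m n) = space M"
  unfolding joint_past_def using joint_past_gen_closed by (rule space_measure_of)

lemma joint_past_subset: "sets (joint_past m n) \<subseteq> events"
  unfolding sets_joint_past by (intro sets.sigma_sets_subset Un_least arrivals_subset marks_subset)

lemma joint_past_mono:
  assumes "m \<le> m'" "n \<le> n'"
  shows "sets (joint_past m n) \<subseteq> sets (joint_past m' n')"
proof -
  have "sets (arrivals m) \<subseteq> sets (arrivals m')" using assms by (intro history_mono) auto
  moreover have "sets (history M {1..n} V borel) \<subseteq> sets (history M {1..n'} V borel)"
    using assms by (intro history_mono) auto
  ultimately show ?thesis unfolding sets_joint_past by (intro sigma_sets_mono') blast
qed

lemma measurable_into_larger: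
  "f \<in> F \<rightarrow>\<^sub>M S \<Longrightarrow> space F = space F' \<Longrightarrow> sets F \<subseteq> sets F' \<Longrightarrow> f \<in> F' \<rightarrow>\<^sub>M S"
  by (auto simp: measurable_def)

lemma T_joint_past: "i \<le> m \<Longrightarrow> T i \<in> borel_measurable (joint_past m n)"
  by (rule measurable_into_larger[of _ "arrivals m"])
    (auto simp: space_joint_past sets_joint_past intro: history_measurable)

lemma holding_joint_past: "holding m \<in> borel_measurable (joint_past (Suc m) n)"
  unfolding holding_def by (intro borel_measurable_diff T_joint_past) auto

lemma V_joint_past: "V (Suc n) \<in> borel_measurable (joint_past m (Suc n))"
  by (rule measurable_into_larger[of _ "history M {1..Suc n} V borel"])
    (auto simp: space_joint_past sets_joint_past intro!: history_measurable)

lemma prob_all_past_marks: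
  assumes "a \<in> sets all_past" "b \<in> sets (history M {1..} V borel)"
  shows "prob (a \<inter> b) = prob a * prob b"
  using indep_setD[OF N_V_indep] assms by (simp add: sets_history)

lemma holding_all_past: "holding m \<in> borel_measurable all_past"
  unfolding holding_def using T_all_past by (intro borel_measurable_diff)

text \<open>
  The arrival times contribute through the strong Markov property, the marks through their independence
  of the whole Poisson process.
\<close>

lemma holding_joint_independent:
  assumes A: "A \<in> sets (joint_past n n)" and B: "B \<in> sets borel"
  shows "prob (A \<inter> (holding n -` B \<inter> space M)) = prob A * prob (holding n -` B \<inter> space M)"
proof -
  define C where "C = range (\<lambda>\<epsilon>. {\<omega>\<in>space M. \<epsilon> < holding n \<omega>})"
  have C_ev: "C \<subseteq> events" by (auto simp: C_def)
  have "indep_set (sigma_sets (space M) (sets (arrivals n) \<union> sets (history M {1..n} V borel)))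
     (sigma_sets (space M) C)"
  proof (rule indep_set_join)
    show "Int_stable C"
    proof (rule Int_stableI)
      fix c d assume "c \<in> C" "d \<in> C"
      then obtain e f where "c = {\<omega>\<in>space M. e < holding n \<omega>}" "d = {\<omega>\<in>space M. f < holding n \<omega>}"
        by (auto simp: C_def)
      then have "c \<inter> d = {\<omega>\<in>space M. max e f < holding n \<omega>}" by auto
      then show "c \<inter> d \<in> C" unfolding C_def by (rule image_eqI) simp
    qed
    show "prob (a \<inter> b \<inter> c) = prob (a \<inter> b) * prob c"
      if a: "a \<in> sets (arrivals n)" and b: "b \<in> sets (history M {1..n} V borel)" and "c \<in> C" for a b c
    proof -
      obtain \<epsilon> where c: "c = {\<omega>\<in>space M. \<epsilon> < holding n \<omega>}" using \<open>c \<in> C\<close> by (auto simp: C_def)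
      have a': "a \<in> sets all_past" using a arrivals_all_past by blast
      have b': "b \<in> sets (history M {1..} V borel)" using b history_mono[of "{1..n}" "{1..}"] by auto
      have "c \<in> sets all_past"
      proof -
        have "holding n -` {\<epsilon><..} \<inter> space all_past \<in> sets all_past"
          by (rule measurable_sets[OF holding_all_past]) simp
        also have "holding n -` {\<epsilon><..} \<inter> space all_past = c" by (auto simp: c)
        finally show ?thesis .
      qed
      then have "prob ((a \<inter> c) \<inter> b) = prob (a \<inter> c) * prob b"
        using a' b' by (intro prob_all_past_marks) auto
      also have "prob (a \<inter> c) = prob a * prob c" unfolding c by (rule holding_independent[OF a])
      also have "prob a * prob c * prob b = prob (a \<inter> b) * prob c"
        using prob_all_past_marks[OF a' b'] by simp
      also have "(a \<inter> c) \<inter> b = a \<inter> b \<inter> c" by auto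
      finally show ?thesis .
    qed
  qed (use C_ev arrivals_subset marks_subset Int_stable_sets sets.top[of "arrivals n"]
      sets.top[of "history M {1..n} V borel"] in auto)
  moreover have "holding n -` B \<inter> space M \<in> sigma_sets (space M) C"
  proof -
    define F where "F = sigma (space M) C"
    have F: "space F = space M" "sets F = sigma_sets (space M) C"
      unfolding F_def using C_ev sets.space_closed by (auto intro!: space_measure_of sets_measure_of simp: C_def)
    have "holding n \<in> borel_measurable F"
      by (rule borel_measurableI_greater) (auto simp: F C_def)
    then show ?thesis using measurable_sets[of "holding n" F borel B] B by (simp add: F)
  qed
  ultimately show ?thesis
    using A unfolding sets_joint_past by (intro indep_setD)
qed

text \<open>
  Here the arrival times enter only as part of the whole Poisson process, which is independent of all marks.
\<close>

lemma V_joint_independent: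
  assumes A: "A \<in> sets (joint_past (Suc n) n)" and B: "B \<in> sets borel"
  shows "prob (A \<inter> (V (Suc n) -` B \<inter> space M)) = prob A * prob (V (Suc n) -` B \<inter> space M)"
proof -
  define C where "C = {V (Suc n) -` B \<inter> space M}"
  have C_ev: "C \<subseteq> events" using V_meas[of "Suc n"] B by (auto simp: C_def intro: measurable_sets)
  have "indep_set (sigma_sets (space M) (sets all_past \<union> sets (history M {1..n} V borel)))
     (sigma_sets (space M) C)"
  proof (rule indep_set_join)
    show "prob (a \<inter> b \<inter> c) = prob (a \<inter> b) * prob c"
      if a: "a \<in> sets all_past" and b: "b \<in> sets (history M {1..n} V borel)" and "c \<in> C" for a b c
    proof -
      have c: "c = V (Suc n) -` B \<inter> space M" using \<open>c \<in> C\<close> by (simp add: C_def)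
      have b': "b \<in> sets (history M {1..} V borel)" using b history_mono[of "{1..n}" "{1..}"] by auto
      have "V (Suc n) \<in> history M {1..} V borel \<rightarrow>\<^sub>M borel" by (rule history_measurable) auto
      then have c': "c \<in> sets (history M {1..} V borel)"
        unfolding c using measurable_sets[of "V (Suc n)" "history M {1..} V borel" borel B] B by simp
      have "prob (a \<inter> (b \<inter> c)) = prob a * prob (b \<inter> c)"
        using a b' c' by (intro prob_all_past_marks) auto
      also have "prob (b \<inter> c) = prob b * prob c" unfolding c by (rule indep_vars_next[OF V_indep b B])
      also have "prob a * (prob b * prob c) = prob (a \<inter> b) * prob c"
        using prob_all_past_marks[OF a b'] by simp
      finally show ?thesis by (simp add: Int_assoc)
    qed
  qed (use C_ev all_past_subset marks_subset Int_stable_sets sets.top[of all_past]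
      sets.top[of "history M {1..n} V borel"] in \<open>auto simp: C_def Int_stable_def\<close>)
  moreover have "A \<in> sigma_sets (space M) (sets all_past \<union> sets (history M {1..n} V borel))"
  proof -
    have "sets (arrivals (Suc n)) \<union> sets (history M {1..n} V borel) \<subseteq> sets all_past \<union> sets (history M {1..n} V borel)"
      using arrivals_all_past by blast
    then show ?thesis using A unfolding sets_joint_past by (rule sigma_sets_mono'[THEN subsetD])
  qed
  moreover have "V (Suc n) -` B \<inter> space M \<in> sigma_sets (space M) C"
    by (rule sigma_sets.Basic) (simp add: C_def)
  ultimately show ?thesis by (intro indep_setD)
qed

lemma embedded_chain:
  assumes "\<kappa> < 0" "integrable G (\<lambda>v. \<bar>v\<bar>)"
  shows "decay_jump_chain M (\<lambda>n. joint_past n n) (\<lambda>n. joint_past (Suc n) n) holding (\<lambda>n. V (Suc n))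
     (density lborel (exponential_density rate)) G \<kappa>"
proof -
  define \<sigma> where "\<sigma> = density lborel (\<lambda>s. ennreal (exponential_density rate s))"
  have \<sigma>: "distr M lborel (holding n) = \<sigma>" for n
    unfolding \<sigma>_def using holding_exponential by (rule distributed_distr_eq_density)
  have G_sets: "sets G = sets borel" using V_distr[of 0] by (metis sets_distr sets_lborel)
  have V_borel: "V (Suc n) \<in> borel_measurable M" for n by (rule V_meas) simp
  show ?thesis
    unfolding \<sigma>_def[symmetric]
  proof (rule decay_jump_chain.intro[OF prob_space_axioms], rule decay_jump_chain_axioms.intro)
    show "subalgebra M (joint_past n n)" "subalgebra M (joint_past (Suc n) n)"
      "subalgebra (joint_past (Suc n) n) (joint_past n n)"
      "subalgebra (joint_past (Suc n) (Suc n)) (joint_past (Suc n) n)" for n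
      unfolding subalgebra_def space_joint_past
      by (auto intro: joint_past_subset[THEN subsetD] joint_past_mono[THEN subsetD, rotated -1])
    show "holding n \<in> borel_measurable (joint_past (Suc n) n)" for n by (rule holding_joint_past)
    show "V (Suc n) \<in> borel_measurable (joint_past (Suc n) (Suc n))" for n by (rule V_joint_past)
    show "prob_space \<sigma>"
      unfolding \<sigma>[of 0, symmetric] by (rule prob_space_distr) simp
    show "prob_space G"
      unfolding V_distr[of 0, symmetric] by (rule prob_space_distr) (simp add: V_borel)
    show "sets \<sigma> = sets borel" by (simp add: \<sigma>_def)
    show "sets G = sets borel" by (rule G_sets)
    show "AE s in \<sigma>. 0 < s"
      using AE_holding_pos[of 0] unfolding \<sigma>[of 0, symmetric] by (subst AE_distr_iff) auto
    show "prob (A \<inter> (holding n -` B \<inter> space M)) = prob A * measure \<sigma> B"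
      if "A \<in> sets (joint_past n n)" "B \<in> sets borel" for n A B
      using holding_joint_independent[OF that] that(2) unfolding \<sigma>[of n, symmetric]
      by (simp add: measure_distr)
    show "prob (A \<inter> (V (Suc n) -` B \<inter> space M)) = prob A * measure G B"
      if "A \<in> sets (joint_past (Suc n) n)" "B \<in> sets borel" for n A B
      using V_joint_independent[OF that] that(2) V_borel[of n] unfolding V_distr[of n, symmetric]
      by (simp add: measure_distr)
  qed (fact assms)+
qed

end

section \<open>Limit law of the undershoot\<close>

theorem theorem4p2:
  fixes M :: "'a measure"
    and N :: "real \<Rightarrow> 'a \<Rightarrow> nat" and V :: "nat \<Rightarrow> 'a \<Rightarrow> real" and X :: "real \<Rightarrow> 'a \<Rightarrow> real"
    and \<kappa> rate p x \<zeta> :: real and r s :: nat and \<alpha> \<mu> \<beta> \<nu> :: "nat \<Rightarrow> real"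
  assumes "prob_space M"
    and "\<kappa> < 0" and "rate > 0"
    and "0 < p" and "p \<le> 1"
    and "hyperexp_parameters r \<alpha> \<mu>" and "hyperexp_parameters s \<beta> \<nu>"
    and "poisson_process M rate N"
    and "\<And>n. n \<ge> 1 \<Longrightarrow> distributed M lborel (V n) (\<lambda>u. ennreal (jump_density p r \<alpha> \<mu> s \<beta> \<nu> u))"
    and "prob_space.indep_vars M (\<lambda>_. borel) V {1..}"
    and "prob_space.indep_set M
           (generated_events M {0..} N (count_space UNIV)) (generated_events M {1..} V borel)"
    and "solves_linear_sde M \<kappa> x (compound_sum N V) X"
    and "x > 0" and "\<zeta> \<ge> 0"
  shows "((\<lambda>l. prob_space.expectation M (\<lambda>\<omega>. exp (- \<zeta> * undershoot X l \<omega>)))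
           \<longlongrightarrow> \<mu> 1 / (\<mu> 1 + \<zeta>)) at_bot"
proof -
  interpret prob_space M by fact
  define G where "G = density lborel (\<lambda>u. ennreal (jump_density p r \<alpha> \<mu> s \<beta> \<nu> u))"
  have V_distr: "distr M lborel (V (Suc n)) = G" for n
    unfolding G_def using assms(9)[of "Suc n"] by (intro distributed_distr_eq_density) simp
  have V_meas: "V n \<in> borel_measurable M" if "1 \<le> n" for n
    using distributed_measurable[OF assms(9)[OF that]] by simp
  have "prob_space G"
    unfolding V_distr[of 0, symmetric] by (rule prob_space_distr) (simp add: V_meas)
  then interpret G: hyperexp_jumps p r s \<alpha> \<mu> \<beta> \<nu> G
    using assms by (intro hyperexp_jumps.intro) (auto simp: G_def)
  interpret marked_poisson M N rate V G
    using assms V_distr V_meas by (intro marked_poisson.intro poisson_paths.intro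
        marked_poisson_axioms.intro poisson_paths_axioms.intro) auto
  interpret chain: decay_jump_chain M "\<lambda>n. joint_past n n" "\<lambda>n. joint_past (Suc n) n" holding
    "\<lambda>n. V (Suc n)" "density lborel (exponential_density rate)" G \<kappa> x
    by (rule embedded_chain) (use assms G.integrable_abs in auto)
  have path: "jump_path (\<lambda>t. N t \<omega>) (\<lambda>i. V i \<omega>) (\<lambda>t. X t \<omega>) \<kappa> x (\<lambda>n. chain.Y n \<omega>)"
    if \<omega>: "\<omega> \<in> space M" for \<omega>
  proof
    show "counting_path (\<lambda>t. N t \<omega>)" using \<omega> by (rule path)
    show "(\<lambda>t. X t \<omega>) integrable_on {0..t}" if "0 \<le> t" for t
      using assms(12) \<omega> that by (auto simp: solves_linear_sde_def)
    show "X t \<omega> = x + integral {0..t} (\<lambda>s. \<kappa> * X s \<omega>) + (\<Sum>i=1..N t \<omega>. V i \<omega>)" if "0 \<le> t" for t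
      using assms(12) \<omega> that by (auto simp: solves_linear_sde_def compound_sum_def)
  qed (simp_all add: holding_def T_def)
  \<comment> \<open>The undershoot agrees with \<open>W\<close> for every outcome and with that of the chain almost surely. Going through
    \<open>W\<close> shows that its expectation is that of a measurable function.\<close>
  define W where "W l \<omega> = (if \<exists>m. (\<exists>t\<ge>0. N t \<omega> = m) \<and> chain.Y m \<omega> \<le> l
     then l - chain.Y (LEAST m. (\<exists>t\<ge>0. N t \<omega> = m) \<and> chain.Y m \<omega> \<le> l) \<omega> else l - x)" for l \<omega>
  have under_eq: "undershoot X l \<omega> = W l \<omega>" if "\<omega> \<in> space M" "l < 0" for l \<omega>
    using jump_path.passage_at_jump[OF path[OF that(1)], of l] assms(2,13) that(2)
    by (simp add: undershoot_def passage_time_def W_def)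
  have W_meas: "W l \<in> borel_measurable M" for l
  proof -
    have P: "Measurable.pred M (\<lambda>\<omega>. (\<exists>t\<ge>0. N t \<omega> = m) \<and> chain.Y m \<omega> \<le> l)" for m
      using level_attained_sets[of m] by (intro pred_intros_logic) (auto simp: pred_def)
    have least: "(\<lambda>\<omega>. LEAST m. (\<exists>t\<ge>0. N t \<omega> = m) \<and> chain.Y m \<omega> \<le> l) \<in> M \<rightarrow>\<^sub>M count_space UNIV"
      by (rule measurable_Least[OF P])
    have "(\<lambda>\<omega>. chain.Y (LEAST m. (\<exists>t\<ge>0. N t \<omega> = m) \<and> chain.Y m \<omega> \<le> l) \<omega>) \<in> borel_measurable M"
      by (rule measurable_compose_countable[OF chain.Y_measurable least])
    moreover have "Measurable.pred M (\<lambda>\<omega>. \<exists>m. (\<exists>t\<ge>0. N t \<omega> = m) \<and> chain.Y m \<omega> \<le> l)"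
      using P by (rule pred_intros_countable)
    ultimately show ?thesis
      unfolding W_def by (intro measurable_If borel_measurable_diff borel_measurable_const) (simp_all add: pred_def)
  qed
  have eq: "(\<integral>\<omega>. exp (- \<zeta> * undershoot X l \<omega>) \<partial>M) = (\<integral>\<omega>. exp (- \<zeta> * chain.chain_undershoot l \<omega>) \<partial>M)"
    if "l < 0" for l
  proof -
    have "(\<integral>\<omega>. exp (- \<zeta> * undershoot X l \<omega>) \<partial>M) = (\<integral>\<omega>. exp (- \<zeta> * W l \<omega>) \<partial>M)"
      by (rule Bochner_Integration.integral_cong) (simp_all add: under_eq that)
    also have "\<dots> = (\<integral>\<omega>. exp (- \<zeta> * chain.chain_undershoot l \<omega>) \<partial>M)"
    proof (rule integral_cong_AE)
      have "chain.tail d = measure G {..- d}" for d by (simp add: chain.tail_def)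
      then have "AE \<omega> in M. \<exists>n. chain.Y n \<omega> \<le> l"
        using G.below_pos by (intro chain.AE_passage) simp
      then show "AE \<omega> in M. exp (- \<zeta> * W l \<omega>) = exp (- \<zeta> * chain.chain_undershoot l \<omega>)"
        using AE_all_levels
      proof eventually_elim
        case (elim \<omega>)
        then show ?case by (simp add: W_def chain.chain_undershoot_def)
      qed
    qed (use W_meas in auto)
    finally show ?thesis .
  qed
  have "((\<lambda>l. \<integral>\<omega>. exp (- \<zeta> * chain.chain_undershoot l \<omega>) \<partial>M) \<longlongrightarrow> \<mu> 1 / (\<mu> 1 + \<zeta>)) at_bot"
    using G.below_pos G.below_shift G.laplace_ratio assms(13,14)
    by (intro chain.undershoot_limit) (auto simp: chain.tail_def chain.excess_laplace_def)
  moreover have "eventually (\<lambda>l. (\<integral>\<omega>. exp (- \<zeta> * chain.chain_undershoot l \<omega>) \<partial>M) =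
      (\<integral>\<omega>. exp (- \<zeta> * undershoot X l \<omega>) \<partial>M)) at_bot"
  proof -
    have "eventually (\<lambda>l::real. l < 0) at_bot"
      unfolding eventually_at_bot_dense by (rule exI[of _ 0]) simp
    then show ?thesis by eventually_elim (rule eq[symmetric])
  qed
  ultimately show ?thesis by (rule Lim_transform_eventually)
qed

end
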